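(* Let $A_1,\dots,A_N\in\mathbb{R}^{n\times n}$ and $0<\delta\le T_{min}\le T_{max}<\infty$. Consider the switched system $$\dot x(t)=A_{\sigma(t)}x(t),\qquad x(0)=x_0,$$ where $\sigma:\mathbb{R}_{\ge0}\to\{1,\dots,N\}$ has switching times $\{t_k\}_{k\in\mathbb{N}}$. Then the following statements (a) and (b) are equivalent, and if they hold then the switched system is asymptotically stable for any dwell-times $T_k:=t_{k+1}-t_k\in[T_{min},T_{max}]$, $k\in\mathbb{N}$: (a) There exist matrices $P_i\in\mathbb{S}^n_{\succ0}$, $i=1,\dots,N$, such that $e^{A_i^{\top}\theta}P_ie^{A_i\theta}-P_j\prec0$ for all $\theta\in[T_{min},T_{max}]$ and all $i,j=1,\dots,N$, $i\neq j$. (b) There exist constant matrices $P_i\in\mathbb{S}^n_{\succ0}$, $i=1,\dots,N$, a scalar $\varepsilon>0$ and matrix functions $Z_{ij}:[0,T_{max}]\times[T_{min},T_{max}]\to\mathbb{S}^{3n}$, $i,j=1,\dots,N$, $i\ne j$, differentiable with respect to the first variable, verifying $$W_2^{\top}Z_{ij}(\theta,\theta)W_2-W_1^{\top}Z_{ij}(0,\theta)W_1=0\quad\text{for all }\theta\in[T_{min},T_{max}],$$ where $$W_1=\begin{bmatrix}I_n&0_n\\ I_n&0_n\\ 0_n&I_n\end{bmatrix},\qquad W_2=\begin{bmatrix}0_n&I_n\\ I_n&0_n\\ 0_n&I_n\end{bmatrix},$$ and such that $$\Theta_{ij}(\theta)+\operatorname{He}\left(Z_{ij}(\tau,\theta)\begin{bmatrix}A_i&0_n&0_n\\0_n&0_n&0_n\\0_n&0_n&0_n\end{bmatrix}\right)+\frac{\partial}{\partial\tau}Z_{ij}(\tau,\theta)\preceq0$$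 for all $\tau\in[0,\theta]$, all $\theta\in[T_{min},T_{max}]$ and all $i,j=1,\dots,N$, $i\neq j$, where $$\Theta_{ij}(\theta):=\begin{bmatrix}\theta\operatorname{He}[P_iA_i]&0_n&0_n\\0_n&\varepsilon I_n+P_i-P_j&0_n\\0_n&0_n&0_n\end{bmatrix}.$$
   Context: Notation: $\mathbb{N}=\{1,2,\dots\}$; $\mathbb{S}^m$ is the set of real symmetric $m\times m$ matrices, $\mathbb{S}^m_{\succ0}$ the positive definite ones; $X\prec Y$ (resp. $X\preceq Y$) means $Y-X$ is positive definite (resp. semidefinite); $\operatorname{He}(X):=X+X^{\top}$; $0_n$ and $I_n$ are the $n\times n$ zero and identity matrices. The switching times satisfy $0=t_0<t_1<t_2<\cdots$; $\sigma$ is constant on each interval $[t_k,t_{k+1})$, $k\ge0$, and its value changes at each $t_k$, $k\in\mathbb{N}$. The state $x(t)\in\mathbb{R}^n$ is continuous. Asymptotic stability for any dwell-times in $[T_{min},T_{max}]$ means that, for every such $\sigma$ with $t_{k+1}-t_k\in[T_{min},T_{max}]$ for all $k\in\mathbb{N}$, the zero solution is Lyapunov stable and $x(t)\to0$ as $t\to\infty$ for every $x_0\in\mathbb{R}^n$. *)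

theory Defs
  imports "HOL-Analysis.Analysis"
begin

section \<open>Matrices\<close>

text \<open>
  The multiplication and power that the type of vectors inherits from its entries are componentwise,
  and the constant \<^const>\<open>exp\<close> is not available on matrices; the matrix exponential is
  therefore introduced through the matrix product \<open>**\<close>.
\<close>

primrec mat_pow :: "real^'n^'n \<Rightarrow> nat \<Rightarrow> real^'n^'n" where
  "mat_pow A 0 = mat 1"
| "mat_pow A (Suc k) = A ** mat_pow A k"

definition mat_exp :: "real^'n^'n \<Rightarrow> real^'n^'n" where
  "mat_exp A = (\<Sum>k. (1 / fact k) *\<^sub>R mat_pow A k)"

definition sym_mat :: "real^'n^'n \<Rightarrow> bool" where
  "sym_mat X \<longleftrightarrow> transpose X = X"

definition pos_def :: "real^'n^'n \<Rightarrow> bool" where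
  "pos_def X \<longleftrightarrow> sym_mat X \<and> (\<forall>v. v \<noteq> 0 \<longrightarrow> v \<bullet> (X *v v) > 0)"

definition pos_semidef :: "real^'n^'n \<Rightarrow> bool" where
  "pos_semidef X \<longleftrightarrow> sym_mat X \<and> (\<forall>v. v \<bullet> (X *v v) \<ge> 0)"

definition loewner_less :: "real^'n^'n \<Rightarrow> real^'n^'n \<Rightarrow> bool" (infix \<open>\<prec>\<^sub>L\<close> 50) where
  "X \<prec>\<^sub>L Y \<longleftrightarrow> pos_def (Y - X)"

definition loewner_le :: "real^'n^'n \<Rightarrow> real^'n^'n \<Rightarrow> bool" (infix \<open>\<preceq>\<^sub>L\<close> 50) where
  "X \<preceq>\<^sub>L Y \<longleftrightarrow> pos_semidef (Y - X)"

definition He :: "real^'n^'n \<Rightarrow> real^'n^'n" where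
  "He X = X + transpose X"


section \<open>Block matrices\<close>

text \<open>
  Block rows and columns are indexed by sum types, so that \<open>3n \<times> 3n\<close> matrices are indexed by
  \<open>'n + 'n + 'n\<close>. As in the usual bracket notation, \<open>\<^bold>|\<close> puts blocks side by side and
  \<open>\<^bold>;\<close>, which binds weaker, starts a new block row.
\<close>

definition hcat :: "real^'a^'m \<Rightarrow> real^'b^'m \<Rightarrow> real^('a + 'b)^'m" (infixr \<open>\<^bold>|\<close> 62) where
  "A \<^bold>| B = (\<chi> r c. case c of Inl a \<Rightarrow> A $ r $ a | Inr b \<Rightarrow> B $ r $ b)"

definition vcat :: "real^'m^'a \<Rightarrow> real^'m^'b \<Rightarrow> real^'m^('a + 'b)" (infixr \<open>\<^bold>;\<close> 61) where
  "A \<^bold>; B = (\<chi> r. case r of Inl a \<Rightarrow> A $ a | Inr b \<Rightarrow> B $ b)"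

definition W1 :: "real^('n::finite + 'n)^('n + 'n + 'n)" where
  "W1 = (mat 1 \<^bold>| 0 \<^bold>;
         mat 1 \<^bold>| 0 \<^bold>;
         0 \<^bold>| mat 1)"

definition W2 :: "real^('n::finite + 'n)^('n + 'n + 'n)" where
  "W2 = (0 \<^bold>| mat 1 \<^bold>;
         mat 1 \<^bold>| 0 \<^bold>;
         0 \<^bold>| mat 1)"

definition diag3 ::
  "real^'n^'n \<Rightarrow> real^'n^'n \<Rightarrow> real^'n^'n \<Rightarrow> real^('n + 'n + 'n)^('n + 'n + 'n)" where
  "diag3 X Y Z = (X \<^bold>| 0 \<^bold>| 0 \<^bold>;
                  0 \<^bold>| Y \<^bold>| 0 \<^bold>;
                  0 \<^bold>| 0 \<^bold>| Z)"

definition Theta ::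
  "(nat \<Rightarrow> real^'n^'n) \<Rightarrow> (nat \<Rightarrow> real^'n^'n) \<Rightarrow> real \<Rightarrow> nat \<Rightarrow> nat \<Rightarrow> real
    \<Rightarrow> real^('n + 'n + 'n)^('n + 'n + 'n)" where
  "Theta A P \<epsilon> i j \<theta> =
     diag3 (\<theta> *\<^sub>R He (P i ** A i)) (\<epsilon> *\<^sub>R mat 1 + P i - P j) 0"


section \<open>The two conditions\<close>

definition dwell_time_condition ::
  "nat \<Rightarrow> (nat \<Rightarrow> real^'n^'n) \<Rightarrow> real \<Rightarrow> real \<Rightarrow> bool" where
  "dwell_time_condition N A Tmin Tmax \<longleftrightarrow>
    (\<exists>P :: nat \<Rightarrow> real^'n^'n.
       (\<forall>i\<in>{1..N}. pos_def (P i)) \<and>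
       (\<forall>\<theta>\<in>{Tmin..Tmax}. \<forall>i\<in>{1..N}. \<forall>j\<in>{1..N}. i \<noteq> j \<longrightarrow>
          mat_exp (\<theta> *\<^sub>R transpose (A i)) ** P i ** mat_exp (\<theta> *\<^sub>R A i) - P j \<prec>\<^sub>L 0))"

text \<open>
  The functions \<open>Z i j\<close> are relevant only on \<open>[0, Tmax] \<times> [Tmin, Tmax]\<close>; derivatives in the
  first variable are one-sided at the end points \<open>0\<close> and \<open>Tmax\<close>.
\<close>

definition looped_functional_condition ::
  "nat \<Rightarrow> (nat \<Rightarrow> real^'n^'n) \<Rightarrow> real \<Rightarrow> real \<Rightarrow> bool" where
  "looped_functional_condition N A Tmin Tmax \<longleftrightarrow>
    (\<exists>(P :: nat \<Rightarrow> real^'n^'n) (\<epsilon> :: real)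
      (Z :: nat \<Rightarrow> nat \<Rightarrow> real \<Rightarrow> real \<Rightarrow> real^('n + 'n + 'n)^('n + 'n + 'n)).
       (\<forall>i\<in>{1..N}. pos_def (P i)) \<and> \<epsilon> > 0 \<and>
       (\<forall>i\<in>{1..N}. \<forall>j\<in>{1..N}. i \<noteq> j \<longrightarrow>
          (\<forall>\<theta>\<in>{Tmin..Tmax}.
             (\<forall>\<tau>\<in>{0..Tmax}. sym_mat (Z i j \<tau> \<theta>)) \<and>
             (\<lambda>\<tau>. Z i j \<tau> \<theta>) differentiable_on {0..Tmax} \<and>
             transpose W2 ** Z i j \<theta> \<theta> ** W2 - transpose W1 ** Z i j 0 \<theta> ** W1 = 0 \<and>
             (\<forall>\<tau>\<in>{0..\<theta>}.
                Theta A P \<epsilon> i j \<theta> + He (Z i j \<tau> \<theta> ** diag3 (A i) 0 0)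
                  + vector_derivative (\<lambda>s. Z i j s \<theta>) (at \<tau> within {0..Tmax}) \<preceq>\<^sub>L 0))))"


section \<open>Switched linear systems\<close>

text \<open>
  The signal \<open>\<sigma>\<close> takes values in \<open>{1..N}\<close> and has exactly the switching times
  \<open>t 1 < t 2 < \<dots>\<close>. The index \<open>0\<close> only marks the initial time \<open>t 0 = 0\<close>, so the first interval
  \<open>[t 0, t 1)\<close> is not subject to the dwell-time bounds below.
\<close>

definition switching_signal :: "nat \<Rightarrow> (real \<Rightarrow> nat) \<Rightarrow> (nat \<Rightarrow> real) \<Rightarrow> bool" where
  "switching_signal N \<sigma> t \<longleftrightarrow>
     (\<forall>s\<ge>0. \<sigma> s \<in> {1..N}) \<and> t 0 = 0 \<and> strict_mono t \<and>
     (\<forall>k. \<forall>s\<in>{t k..<t (Suc k)}. \<sigma> s = \<sigma> (t k)) \<and>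
     (\<forall>k. \<sigma> (t (Suc k)) \<noteq> \<sigma> (t k))"

definition dwell_times_in :: "real \<Rightarrow> real \<Rightarrow> (nat \<Rightarrow> real) \<Rightarrow> bool" where
  "dwell_times_in Tmin Tmax t \<longleftrightarrow> (\<forall>k\<ge>1. t (Suc k) - t k \<in> {Tmin..Tmax})"

text \<open>
  A solution is continuous and satisfies the differential equation at all positive times that are
  not switching times (where \<open>x\<close> is in general not differentiable).
\<close>

definition switched_solution ::
  "(nat \<Rightarrow> real^'n^'n) \<Rightarrow> (real \<Rightarrow> nat) \<Rightarrow> (nat \<Rightarrow> real) \<Rightarrow> real^'n \<Rightarrow> (real \<Rightarrow> real^'n) \<Rightarrow> bool" where
  "switched_solution A \<sigma> t x0 x \<longleftrightarrow>
     x 0 = x0 \<and> continuous_on {0..} x \<and>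
     (\<forall>k. \<forall>s\<in>{t k<..<t (Suc k)}. (x has_vector_derivative A (\<sigma> s) *v x s) (at s))"

definition asymptotically_stable_signal ::
  "(nat \<Rightarrow> real^'n^'n) \<Rightarrow> (real \<Rightarrow> nat) \<Rightarrow> (nat \<Rightarrow> real) \<Rightarrow> bool" where
  "asymptotically_stable_signal A \<sigma> t \<longleftrightarrow>
     (\<forall>e>0. \<exists>d>0. \<forall>x0 x. switched_solution A \<sigma> t x0 x \<and> norm x0 < d \<longrightarrow> (\<forall>s\<ge>0. norm (x s) < e)) \<and>
     (\<forall>x0 x. switched_solution A \<sigma> t x0 x \<longrightarrow> (x \<longlongrightarrow> 0) at_top)"

definition asymptotically_stable_dwell ::
  "nat \<Rightarrow> (nat \<Rightarrow> real^'n^'n) \<Rightarrow> real \<Rightarrow> real \<Rightarrow> bool" where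
  "asymptotically_stable_dwell N A Tmin Tmax \<longleftrightarrow>
     (\<forall>\<sigma> t. switching_signal N \<sigma> t \<and> dwell_times_in Tmin Tmax t
        \<longrightarrow> asymptotically_stable_signal A \<sigma> t)"

end

theory Submission
  imports Defs
begin

text \<open>
  If the linear matrix inequalities hold, the loop condition says that \<open>\<xi>\<^sup>T Z \<xi>\<close> takes the same value at
  both ends of \<open>[0, \<theta>]\<close> along \<open>\<xi>(\<tau>) = (exp(A \<tau>) v, v, exp(A \<theta>) v)\<close>; integrating the inequality along
  \<open>\<xi>\<close> leaves the dwell-time inequality multiplied by \<open>\<theta>\<close>. Conversely, compactness makes the dwell-time
  inequality uniform with some margin \<open>\<epsilon>\<close>, and \<open>Z\<close> can be written down explicitly. Stability follows
  because the dwell-time inequality contracts a quadratic form of the state by a fixed factor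
  between consecutive switching times, while the state grows by a bounded factor in between.
\<close>

section \<open>Matrix algebra\<close>

text \<open>The matrix inequality must hold for all triples (a, b, c), although only those lying on
  a trajectory matter. This shapes the explicit \<open>Z\<close>: it is chosen so that every term in
  a and c cancels and the dwell-time inequality at b is left, for every \<tau>. The terms in c and
  the factor G enter for the sake of the loop condition, which relates b and c without assuming c =
  E b. The factor \<theta> in the first block of \<open>Theta\<close> balances the second block,
  whose form is constant along the trajectory and accumulates over a time span of length \<theta>.
  For stability the obstacle is the initial interval, which is not subject to the dwell-time bounds
  and may be arbitrarily long: contraction starts only at \<open>t 1\<close>, and the constants
  depend on the signal through \<open>t 1\<close>.\<close>

lemma bounded_bilinear_matrix_matrix_mult:
  "bounded_bilinear ((**) :: real^'n^'m \<Rightarrow> real^'p^'n \<Rightarrow> real^'p^'m)"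
  unfolding bilinear_conv_bounded_bilinear[symmetric]
  by (auto simp: bilinear_def matrix_matrix_mult_def vec_eq_iff algebra_simps sum.distrib
      sum_distrib_left intro!: linearI)

lemma bounded_bilinear_matrix_vector_mult:
  "bounded_bilinear ((*v) :: real^'n^'m \<Rightarrow> real^'n \<Rightarrow> real^'m)"
  unfolding bilinear_conv_bounded_bilinear[symmetric]
  by (auto simp: bilinear_def matrix_vector_mult_def vec_eq_iff algebra_simps sum.distrib
      sum_distrib_left intro!: linearI)

lemmas matrix_mult_scaleR_left = bounded_bilinear.scaleR_left[OF bounded_bilinear_matrix_matrix_mult]
lemmas matrix_mult_scaleR_right = bounded_bilinear.scaleR_right[OF bounded_bilinear_matrix_matrix_mult]

lemma bounded_linear_transpose: "bounded_linear (transpose :: real^'n^'m \<Rightarrow> real^'m^'n)"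
  unfolding linear_conv_bounded_linear[symmetric]
  by (auto simp: transpose_def vec_eq_iff intro!: linearI)

lemma transpose_add: "transpose (X + Y) = transpose X + transpose (Y :: real^'n^'m)"
  by (rule linear_add[OF bounded_linear.linear[OF bounded_linear_transpose]])

lemma transpose_diff: "transpose (X - Y) = transpose X - transpose (Y :: real^'n^'m)"
  by (rule linear_diff[OF bounded_linear.linear[OF bounded_linear_transpose]])

lemma transpose_uminus: "transpose (- X) = - transpose (X :: real^'n^'m)"
  by (rule linear_neg[OF bounded_linear.linear[OF bounded_linear_transpose]])

lemma transpose_zero [simp]: "transpose 0 = (0 :: real^'n^'m)"
  by (simp add: transpose_def vec_eq_iff)

lemma matrix_vector_uminus: "(- X) *v v = - (X *v v)" for X :: "real^'n^'m"
  using matrix_vector_mult_diff_rdistrib[of 0 X v] by simp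

section \<open>Symmetric matrices and quadratic forms\<close>

lemma inner_transpose: "u \<bullet> (transpose X *v v) = (X *v u) \<bullet> v" for X :: "real^'n^'m"
  using dot_lmul_matrix[of v X u] by (simp add: inner_commute)

lemma inner_sym_mat:
  assumes "sym_mat X"
  shows "u \<bullet> (X *v v) = (X *v u) \<bullet> v"
  using assms inner_transpose[of u X v] by (simp only: sym_mat_def)

lemma sym_mat_zero: "sym_mat 0"
  by (simp add: sym_mat_def)

lemma sym_mat_mat: "sym_mat (mat c)"
  by (simp add: sym_mat_def)

lemma sym_mat_add: "sym_mat X \<Longrightarrow> sym_mat Y \<Longrightarrow> sym_mat (X + Y)"
  by (simp add: sym_mat_def transpose_add)

lemma sym_mat_diff: "sym_mat X \<Longrightarrow> sym_mat Y \<Longrightarrow> sym_mat (X - Y)"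
  by (simp add: sym_mat_def transpose_diff)

lemma sym_mat_scaleR: "sym_mat X \<Longrightarrow> sym_mat (c *\<^sub>R X)"
  by (simp add: sym_mat_def transpose_scalar)

lemma sym_mat_He: "sym_mat (He X)"
  by (simp add: sym_mat_def He_def transpose_add add.commute)

lemma sym_mat_congruence:
  fixes X :: "real^'n^'n" and B :: "real^'m^'n"
  shows "sym_mat X \<Longrightarrow> sym_mat (transpose B ** X ** B)"
  by (simp add: sym_mat_def matrix_transpose_mul matrix_mul_assoc)

lemmas sym_mat_intros = sym_mat_zero sym_mat_mat sym_mat_add sym_mat_diff
  sym_mat_scaleR sym_mat_He sym_mat_congruence

text \<open>Polarization: symmetry merges the two mixed terms of the form at \<open>u + v\<close>,
  so the bilinear form vanishes as well. This reduces the loop condition, an identity of matrices,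
  to one of quadratic forms.\<close>

lemma sym_mat_eq_0:
  assumes X: "sym_mat X" and quad: "\<And>v. v \<bullet> (X *v v) = 0"
  shows "X = 0"
proof -
  have "u \<bullet> (X *v v) = 0" for u v
    using quad[of "u + v"] quad[of u] quad[of v] inner_sym_mat[OF X, of u v]
    by (simp add: algebra_simps inner_add_left inner_add_right inner_commute)
  then have "X *v v = 0 *v v" for v
    by (metis inner_eq_zero_iff matrix_vector_mult_0)
  then show ?thesis
    by (simp add: matrix_eq del: matrix_vector_mult_0)
qed

lemma quadratic_congruence:
  "v \<bullet> ((transpose B ** X ** B) *v v) = (B *v v) \<bullet> (X *v (B *v v))"
  for X :: "real^'n^'n" and B :: "real^'m^'n"
  by (simp only: matrix_vector_mul_assoc[symmetric] inner_transpose)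

lemma quadratic_He: "v \<bullet> (He X *v v) = 2 * (v \<bullet> (X *v v))"
  by (simp only: He_def matrix_vector_mult_add_rdistrib inner_add_right inner_transpose
      inner_commute[of "X *v v"])

lemma loewner_less_zero: "X \<prec>\<^sub>L 0 \<longleftrightarrow> sym_mat X \<and> (\<forall>v. v \<noteq> 0 \<longrightarrow> v \<bullet> (X *v v) < 0)"
  by (auto simp: loewner_less_def pos_def_def sym_mat_def transpose_uminus matrix_vector_uminus)

lemma loewner_le_zero: "X \<preceq>\<^sub>L 0 \<longleftrightarrow> sym_mat X \<and> (\<forall>v. v \<bullet> (X *v v) \<le> 0)"
  by (auto simp: loewner_le_def pos_semidef_def sym_mat_def transpose_uminus matrix_vector_uminus)

text \<open>The form is continuous on the product of \<open>K\<close> and the unit sphere; its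
  minimum there is positive by definiteness, and homogeneity of degree two carries the bound to all
  \<open>v\<close>. An empty \<open>K\<close> has no minimizer, and any constant serves.\<close>

lemma quadratic_lower_bound:
  fixes M :: "real \<Rightarrow> real^'n^'n"
  assumes "compact K" and cont: "continuous_on K M" and pd: "\<And>s. s \<in> K \<Longrightarrow> pos_def (M s)"
  shows "\<exists>m>0. \<forall>s\<in>K. \<forall>v. m * (norm v)\<^sup>2 \<le> v \<bullet> (M s *v v)"
proof (cases "K = {}")
  case False
  define S where "S = sphere (0::real^'n) 1"
  define q where "q p = snd p \<bullet> (M (fst p) *v snd p)" for p
  have "continuous_on (K \<times> S) (\<lambda>p. M (fst p))"
    by (rule continuous_on_compose2[OF cont]) (auto intro: continuous_on_fst continuous_on_id)
  then have "continuous_on (K \<times> S) q"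
    unfolding q_def
    by (intro continuous_on_inner continuous_on_snd continuous_on_id
        bounded_bilinear.continuous_on[OF bounded_bilinear_matrix_vector_mult])
  moreover obtain w where w: "w \<in> S"
    using vector_choose_size[of 1] by (auto simp: S_def)
  moreover have "compact (K \<times> S)"
    using \<open>compact K\<close> by (simp add: S_def compact_Times)
  ultimately obtain p where p: "p \<in> K \<times> S" and min: "\<forall>p'\<in>K \<times> S. q p \<le> q p'"
    using continuous_attains_inf[of "K \<times> S" q] False by blast
  have "q p * (norm v)\<^sup>2 \<le> v \<bullet> (M s *v v)" if s: "s \<in> K" for s v
  proof (cases "v = 0")
    case False
    define u where "u = v /\<^sub>R norm v"
    have "u \<in> S"
      using False by (simp add: S_def u_def)
    then have "q p * (norm v)\<^sup>2 \<le> q (s, u) * (norm v)\<^sup>2"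
      using min s by (intro mult_right_mono) auto
    also have "\<dots> = (norm v *\<^sub>R u) \<bullet> (M s *v (norm v *\<^sub>R u))"
      by (simp add: q_def matrix_vector_mult_scaleR power2_eq_square)
    also have "norm v *\<^sub>R u = v"
      by (simp add: u_def False)
    finally show ?thesis .
  qed simp
  moreover have "snd p \<noteq> 0"
    using p by (auto simp: S_def)
  then have "q p > 0"
    using p pd[of "fst p"] by (simp add: pos_def_def q_def mem_Times_iff)
  ultimately show ?thesis
    by blast
qed (auto intro: exI[of _ 1])

lemma pos_def_lower_bound:
  assumes "pos_def X"
  obtains m where "m > 0" "\<And>v. m * (norm v)\<^sup>2 \<le> v \<bullet> (X *v v)"
  using quadratic_lower_bound[of "{0}" "\<lambda>_. X"] assms by (metis compact_sing continuous_on_const singletonI)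

lemma quadratic_upper_bound:
  fixes X :: "real^'n^'n"
  obtains c where "c > 0" "\<And>v. v \<bullet> (X *v v) \<le> c * (norm v)\<^sup>2"
proof -
  obtain c where "c > 0" and c: "\<And>v. norm (X *v v) \<le> norm v * c"
    using bounded_linear.pos_bounded[OF matrix_vector_mul_bounded_linear[of X]] by metis
  have "v \<bullet> (X *v v) \<le> c * (norm v)\<^sup>2" for v
    using norm_cauchy_schwarz[of v "X *v v"] mult_left_mono[OF c[of v], of "norm v"]
    by (simp add: power2_eq_square algebra_simps)
  with \<open>c > 0\<close> show ?thesis
    using that by blast
qed


section \<open>The matrix exponential\<close>

lemma mat_pow_scaleR: "mat_pow (c *\<^sub>R A) k = c ^ k *\<^sub>R mat_pow A k"
  by (induction k)
    (simp_all add: matrix_mult_scaleR_left matrix_mult_scaleR_right)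

lemma mat_pow_commute: "A ** mat_pow A k = mat_pow A k ** A"
  by (induction k) (simp, metis mat_pow.simps(2) matrix_mul_assoc)

lemma transpose_mat_pow: "transpose (mat_pow A k) = mat_pow (transpose A) k"
  by (induction k) (simp_all add: matrix_transpose_mul mat_pow_commute)

text \<open>The constant is the sum of all absolute entries. It dominates every row sum, so each
  further factor \<open>A\<close> costs at most \<open>K\<close>. Entrywise bounds reduce the matrix
  exponential to real power series.\<close>

lemma mat_pow_entry_bound:
  fixes A :: "real^'n^'n"
  obtains K where "K \<ge> 0" "\<And>k i j. \<bar>mat_pow A k $ i $ j\<bar> \<le> K ^ k"
proof
  define K where "K = (\<Sum>i\<in>UNIV. \<Sum>l\<in>UNIV. \<bar>A $ i $ l\<bar>)"
  show "K \<ge> 0"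
    by (auto simp: K_def intro!: sum_nonneg)
  have row: "(\<Sum>l\<in>UNIV. \<bar>A $ i $ l\<bar>) \<le> K" for i
    unfolding K_def by (rule member_le_sum) (auto intro: sum_nonneg)
  show "\<bar>mat_pow A k $ i $ j\<bar> \<le> K ^ k" for k i j
  proof (induction k arbitrary: i)
    case 0
    show ?case by (simp add: mat_def)
  next
    case (Suc k)
    have "\<bar>mat_pow A (Suc k) $ i $ j\<bar> \<le> (\<Sum>l\<in>UNIV. \<bar>A $ i $ l\<bar> * K ^ k)"
      unfolding mat_pow.simps matrix_matrix_mult_def
      by (auto simp: abs_mult intro!: order.trans[OF sum_abs] sum_mono mult_left_mono Suc)
    also have "\<dots> \<le> K * K ^ k"
      unfolding sum_distrib_right[symmetric]
      using row \<open>K \<ge> 0\<close> by (intro mult_right_mono) auto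
    finally show ?case by simp
  qed
qed

lemma summable_mat_exp_entry:
  fixes A :: "real^'n^'n"
  shows "summable (\<lambda>k. mat_pow A k $ i $ j / fact k * s ^ k)"
proof -
  obtain K where "K \<ge> 0" and K: "\<And>k i j. \<bar>mat_pow A k $ i $ j\<bar> \<le> K ^ k"
    using mat_pow_entry_bound[of A] by metis
  show ?thesis
  proof (rule summable_comparison_test[OF _ summable_exp[of "K * \<bar>s\<bar>"]], intro exI allI impI)
    fix k
    show "norm (mat_pow A k $ i $ j / fact k * s ^ k) \<le> inverse (fact k) * (K * \<bar>s\<bar>) ^ k"
      using mult_right_mono[OF K[of k i j], of "\<bar>s\<bar> ^ k / fact k"]
      by (simp add: abs_mult power_abs power_mult_distrib field_simps)
  qed
qed

lemma sums_matrixI: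
  fixes f :: "nat \<Rightarrow> real^'n^'m"
  assumes "\<And>i j. (\<lambda>k. f k $ i $ j) sums (L $ i $ j)"
  shows "f sums L"
  using assms unfolding sums_def by (auto intro!: vec_tendstoI)

lemma mat_exp_sums_entries:
  fixes A :: "real^'n^'n"
  shows "(\<lambda>k. (s ^ k / fact k) *\<^sub>R mat_pow A k) sums
    (\<chi> i j. \<Sum>k. mat_pow A k $ i $ j / fact k * s ^ k)"
  using summable_sums[OF summable_mat_exp_entry[of A _ _ s]]
  by (intro sums_matrixI) (simp add: mult.commute)

lemma mat_exp_scaleR_sums: "(\<lambda>k. (s ^ k / fact k) *\<^sub>R mat_pow A k) sums mat_exp (s *\<^sub>R A)"
  using mat_exp_sums_entries[of s A]
  by (simp add: mat_exp_def mat_pow_scaleR sums_iff)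

lemma mat_exp_sums: "(\<lambda>k. (1 / fact k) *\<^sub>R mat_pow A k) sums mat_exp A"
  using mat_exp_scaleR_sums[of 1 A] by simp

lemma mat_exp_entry:
  "mat_exp (s *\<^sub>R A) $ i $ j = (\<Sum>k. mat_pow A k $ i $ j / fact k * s ^ k)"
  using sums_unique2[OF mat_exp_scaleR_sums mat_exp_sums_entries, of s A] by simp

lemma mat_exp_0 [simp]: "mat_exp 0 = mat 1"
proof -
  \<comment> \<open>Zero is written as a multiple of a matrix, so that each entry is a power series
    at 0, where only the constant coefficient survives.\<close>
  have "mat_exp (0 *\<^sub>R mat 1 :: real^'a^'a) $ i $ j = mat 1 $ i $ j" for i j
    unfolding mat_exp_entry using powser_zero[of "\<lambda>k. mat_pow (mat 1) k $ i $ j / fact k"]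
    by simp
  then show ?thesis
    unfolding vec_eq_iff by simp
qed

lemma mat_exp_commute: "A ** mat_exp (s *\<^sub>R A) = mat_exp (s *\<^sub>R A) ** A"
proof -
  have "(\<lambda>k. A ** ((s ^ k / fact k) *\<^sub>R mat_pow A k)) sums (A ** mat_exp (s *\<^sub>R A))"
    by (rule bounded_linear.sums[OF bounded_bilinear.bounded_linear_right[OF
          bounded_bilinear_matrix_matrix_mult] mat_exp_scaleR_sums])
  moreover have "(\<lambda>k. ((s ^ k / fact k) *\<^sub>R mat_pow A k) ** A) sums (mat_exp (s *\<^sub>R A) ** A)"
    by (rule bounded_linear.sums[OF bounded_bilinear.bounded_linear_left[OF
          bounded_bilinear_matrix_matrix_mult] mat_exp_scaleR_sums])
  ultimately show ?thesis
    by (simp add: matrix_mult_scaleR_left matrix_mult_scaleR_right mat_pow_commute sums_unique2)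
qed

lemma transpose_mat_exp: "mat_exp (transpose A) = transpose (mat_exp A)"
  using bounded_linear.sums[OF bounded_linear_transpose mat_exp_sums[of A]]
    mat_exp_sums[of "transpose A"]
  by (simp add: transpose_scalar transpose_mat_pow sums_unique2)

text \<open>Termwise differentiation of an everywhere convergent power series: in
  \<open>diffs\<close> the factor k + 1 cancels against the factorial, which leaves the coefficients
  of \<open>A\<close> times the exponential.\<close>

lemma mat_exp_entry_has_derivative:
  "((\<lambda>s. mat_exp (s *\<^sub>R A) $ i $ j) has_real_derivative (A ** mat_exp (s *\<^sub>R A)) $ i $ j) (at s)"
proof -
  let ?c = "\<lambda>k. mat_pow A k $ i $ j / fact k"
  have "(\<lambda>k. A ** ((s ^ k / fact k) *\<^sub>R mat_pow A k)) sums (A ** mat_exp (s *\<^sub>R A))"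
    by (rule bounded_linear.sums[OF bounded_bilinear.bounded_linear_right[OF
          bounded_bilinear_matrix_matrix_mult] mat_exp_scaleR_sums])
  then have "(\<lambda>k. (A ** ((s ^ k / fact k) *\<^sub>R mat_pow A k)) $ i $ j)
      sums ((A ** mat_exp (s *\<^sub>R A)) $ i $ j)"
    unfolding sums_def by (auto dest!: tendsto_vec_nth)
  moreover have "(A ** ((s ^ k / fact k) *\<^sub>R mat_pow A k)) $ i $ j = diffs ?c k * s ^ k" for k
    by (simp add: diffs_def matrix_mult_scaleR_right field_simps
        del: of_nat_Suc)
  ultimately have "(A ** mat_exp (s *\<^sub>R A)) $ i $ j = (\<Sum>k. diffs ?c k * s ^ k)"
    by (simp add: sums_iff)
  then show ?thesis
    unfolding mat_exp_entry
    using termdiffs_strong_converges_everywhere[OF summable_mat_exp_entry[of A i j]]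
    by simp
qed

lemma mat_exp_has_vector_derivative:
  "((\<lambda>s. mat_exp (s *\<^sub>R A)) has_vector_derivative A ** mat_exp (s *\<^sub>R A)) (at s within S)"
proof (rule has_vector_derivative_at_within)
  show "((\<lambda>s. mat_exp (s *\<^sub>R A)) has_vector_derivative A ** mat_exp (s *\<^sub>R A)) (at s)"
    unfolding has_vector_derivative_def
  proof (subst has_derivative_componentwise_within, intro ballI)
    fix b :: "real^'a^'a"
    assume "b \<in> Basis"
    then obtain i j where b: "b = axis i (axis j 1)"
      by (auto simp: Basis_vec_def)
    show "((\<lambda>s. mat_exp (s *\<^sub>R A) \<bullet> b) has_derivative
        (\<lambda>h. (h *\<^sub>R (A ** mat_exp (s *\<^sub>R A))) \<bullet> b)) (at s)"
      using mat_exp_entry_has_derivative[of A i j s]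
      by (simp add: b inner_axis has_field_derivative_def mult_commute_abs)
  qed
qed

lemma mat_exp_flow_has_vector_derivative:
  "((\<lambda>s. mat_exp (s *\<^sub>R A) *v v) has_vector_derivative A *v (mat_exp (s *\<^sub>R A) *v v))
    (at s within S)"
  using bounded_linear.has_vector_derivative[OF bounded_bilinear.bounded_linear_left[OF
      bounded_bilinear_matrix_vector_mult, of v] mat_exp_has_vector_derivative[of A s S]]
  by (simp add: matrix_vector_mul_assoc)

text \<open>Commutation puts \<open>A\<close> to the right of the exponential, next to the state,
  where it cancels against the derivative of a trajectory.\<close>

lemma mat_exp_backward_has_vector_derivative:
  "((\<lambda>s. mat_exp ((\<theta> - s) *\<^sub>R A)) has_vector_derivative - (mat_exp ((\<theta> - s) *\<^sub>R A) ** A))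
    (at s within S)"
proof -
  have "((\<lambda>s. \<theta> - s) has_vector_derivative - 1) (at s within S)"
    by (auto intro!: derivative_eq_intros)
  from vector_diff_chain_within[OF this mat_exp_has_vector_derivative[of A]]
  show ?thesis
    by (simp add: o_def mat_exp_commute)
qed

lemma continuous_on_mat_exp: "continuous_on S (\<lambda>s. mat_exp (s *\<^sub>R A))"
  by (rule continuous_on_vector_derivative[OF mat_exp_has_vector_derivative])

text \<open>
  Moving the state along the flow to the fixed final time \<open>b\<close> makes it constant; no group law for
  the exponential is needed.
\<close>

lemma linear_ode_solution:
  fixes A :: "real^'n^'n"
  assumes "a \<le> b" and cont: "continuous_on {a..b} x"
    and ode: "\<And>s. s \<in> {a<..<b} \<Longrightarrow> (x has_vector_derivative A *v x s) (at s)"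
  shows "x b = mat_exp ((b - a) *\<^sub>R A) *v x a"
proof (cases "a = b")
  case False
  let ?y = "\<lambda>s. mat_exp ((b - s) *\<^sub>R A) *v x s"
  have "continuous_on {a..b} ?y"
    by (intro bounded_bilinear.continuous_on[OF bounded_bilinear_matrix_vector_mult] cont
        continuous_on_vector_derivative[OF mat_exp_backward_has_vector_derivative])
  moreover have "(?y has_vector_derivative 0) (at s)" if "s \<in> {a<..<b}" for s
    using bounded_bilinear.has_vector_derivative[OF bounded_bilinear_matrix_vector_mult
        mat_exp_backward_has_vector_derivative[of b A s UNIV] ode[OF that]]
    by (simp add: matrix_vector_uminus matrix_vector_mul_assoc)
  ultimately have "?y b = ?y a"
    using \<open>a \<le> b\<close> False
    \<comment> \<open>The end points form the finite exceptional set: the differential equation is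
      assumed only between them, and \<open>?y\<close> is merely continuous there.\<close>
    by (intro has_derivative_zero_unique_strong_interval[of "{a, b}" a b ?y "?y a" b])
      (auto simp: has_vector_derivative_def has_derivative_at_withinI)
  then show ?thesis
    by simp
qed simp


section \<open>Block vectors\<close>

definition vjoin :: "real^'a \<Rightarrow> real^'b \<Rightarrow> real^('a + 'b)" where
  "vjoin u v = (\<chi> k. case k of Inl a \<Rightarrow> u $ a | Inr b \<Rightarrow> v $ b)"

lemma sum_UNIV_sum_type:
  "(\<Sum>k\<in>UNIV. f k) = (\<Sum>a\<in>UNIV. f (Inl a)) + (\<Sum>b\<in>UNIV. f (Inr b))"
  for f :: "'a::finite + 'b::finite \<Rightarrow> real"
  by (simp add: UNIV_Plus_UNIV[symmetric] sum.Plus del: UNIV_Plus_UNIV)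

lemma hcat_mult_vjoin [simp]: "(X \<^bold>| Y) *v vjoin u v = X *v u + Y *v v"
  by (simp add: vec_eq_iff matrix_vector_mult_def hcat_def vjoin_def sum_UNIV_sum_type)

lemma vcat_mult [simp]: "(X \<^bold>; Y) *v w = vjoin (X *v w) (Y *v w)"
  by (auto simp: vec_eq_iff matrix_vector_mult_def vcat_def vjoin_def split: sum.split)

lemma inner_vjoin [simp]: "vjoin u v \<bullet> vjoin u' v' = u \<bullet> u' + v \<bullet> v'"
  by (simp add: inner_vec_def vjoin_def sum_UNIV_sum_type)

lemma vjoin_exhaust:
  obtains u v where "w = vjoin u v"
proof
  show "w = vjoin (\<chi> a. w $ Inl a) (\<chi> b. w $ Inr b)"
    by (auto simp: vec_eq_iff vjoin_def split: sum.split)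
qed

lemma vjoin_0 [simp]: "vjoin 0 0 = 0"
  by (auto simp: vec_eq_iff vjoin_def split: sum.split)

lemma vjoin_has_vector_derivative:
  assumes "(f has_vector_derivative f') F" "(g has_vector_derivative g') F"
  shows "((\<lambda>s. vjoin (f s) (g s)) has_vector_derivative vjoin f' g') F"
proof -
  have *: "vjoin u v = (mat 1 \<^bold>; 0) *v u + (0 \<^bold>; mat 1) *v v" for u :: "real^'a" and v :: "real^'b"
    by (auto simp: vec_eq_iff vjoin_def split: sum.split)
  show ?thesis
    unfolding *
    by (intro has_vector_derivative_add assms
        bounded_linear.has_vector_derivative[OF matrix_vector_mul_bounded_linear])
qed

lemma W1_mult [simp]: "W1 *v vjoin u v = vjoin u (vjoin u v)"
  by (simp add: W1_def)

lemma W2_mult [simp]: "W2 *v vjoin u v = vjoin v (vjoin u v)"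
  by (simp add: W2_def)

lemma diag3_mult [simp]:
  "diag3 X Y Z *v vjoin a (vjoin b c) = vjoin (X *v a) (vjoin (Y *v b) (Z *v c))"
  by (simp add: diag3_def)

lemma sym_mat_diag3:
  assumes "sym_mat X" "sym_mat Y" "sym_mat Z"
  shows "sym_mat (diag3 X Y Z)"
  using assms unfolding sym_mat_def diag3_def transpose_def vec_eq_iff hcat_def vcat_def
  by (auto split: sum.split)

lemma quadratic_Theta:
  "vjoin a (vjoin b c) \<bullet> (Theta A P \<epsilon> i j \<theta> *v vjoin a (vjoin b c)) =
    2 * \<theta> * (a \<bullet> (P i *v (A i *v a))) + \<epsilon> * (norm b)\<^sup>2 + b \<bullet> (P i *v b) - b \<bullet> (P j *v b)"
  by (simp add: Theta_def scaleR_matrix_vector_assoc[symmetric] quadratic_He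
      matrix_vector_mul_assoc[symmetric] matrix_vector_mult_add_rdistrib
      matrix_vector_mult_diff_rdistrib inner_add_right inner_diff_right power2_norm_eq_inner)

lemma sym_mat_Theta: "sym_mat (P i) \<Longrightarrow> sym_mat (P j) \<Longrightarrow> sym_mat (Theta A P \<epsilon> i j \<theta>)"
  unfolding Theta_def by (intro sym_mat_diag3 sym_mat_intros)


section \<open>From the looped functional to the dwell-time inequality\<close>

text \<open>The mean value theorem replaces integration, since the derivative of \<open>Z\<close>
  exists pointwise but need not be integrable.\<close>

lemma has_vector_derivative_nonpos_imp_le:
  fixes f :: "real \<Rightarrow> real"
  assumes "a \<le> b"
    and f: "\<And>s. s \<in> {a..b} \<Longrightarrow> (f has_vector_derivative f' s) (at s within {a..b})"
    and "\<And>s. s \<in> {a..b} \<Longrightarrow> f' s \<le> 0"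
  shows "f b \<le> f a"
proof -
  obtain s where "s \<in> {a..b}" "f b - f a = (b - a) * f' s"
    using mvt_very_simple[OF \<open>a \<le> b\<close>, of f "\<lambda>s h. h *\<^sub>R f' s"] f
    by (auto simp: has_vector_derivative_def)
  then show ?thesis
    using assms mult_nonneg_nonpos[of "b - a" "f' s"] by simp
qed

text \<open>Symmetry identifies the two product-rule terms that contain \<open>x'\<close>; the
  resulting factor 2 matches the one in the quadratic form of \<open>He\<close>.\<close>

lemma quadratic_has_vector_derivative:
  assumes x: "(x has_vector_derivative x') (at s within S)"
    and Z: "(Z has_vector_derivative Z') (at s within S)"
    and sym: "sym_mat (Z s)"
  shows "((\<lambda>s. x s \<bullet> (Z s *v x s)) has_vector_derivative
    2 * (x s \<bullet> (Z s *v x')) + x s \<bullet> (Z' *v x s)) (at s within S)"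
  using bounded_bilinear.has_vector_derivative[OF bounded_bilinear_inner x
      bounded_bilinear.has_vector_derivative[OF bounded_bilinear_matrix_vector_mult Z x]]
    inner_sym_mat[OF sym, of x' "x s"]
  by (simp add: inner_add_right inner_commute algebra_simps)

lemma looped_functional_imp_decrease:
  fixes A P :: "nat \<Rightarrow> real^'n^'n" and Z :: "real \<Rightarrow> real^('n + 'n + 'n)^('n + 'n + 'n)"
  assumes "0 < \<theta>" "\<theta> \<le> T" and P: "sym_mat (P i)"
    and Z: "\<And>\<tau>. \<tau> \<in> {0..T} \<Longrightarrow> sym_mat (Z \<tau>)" "Z differentiable_on {0..T}"
    and loop: "transpose W2 ** Z \<theta> ** W2 - transpose W1 ** Z 0 ** W1 = 0"
    and lmi: "\<And>\<tau>. \<tau> \<in> {0..\<theta>} \<Longrightarrow> Theta A P \<epsilon> i j \<theta> + He (Z \<tau> ** diag3 (A i) 0 0)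
      + vector_derivative Z (at \<tau> within {0..T}) \<preceq>\<^sub>L 0"
  defines "E \<equiv> \<lambda>s. mat_exp (s *\<^sub>R A i)"
  shows "(E \<theta> *v v) \<bullet> (P i *v (E \<theta> *v v)) + \<epsilon> * (norm v)\<^sup>2 \<le> v \<bullet> (P j *v v)"
proof -
  let ?\<xi> = "\<lambda>\<tau>. vjoin (E \<tau> *v v) (vjoin v (E \<theta> *v v))"
  let ?D = "diag3 (A i) 0 0 :: real^('n + 'n + 'n)^('n + 'n + 'n)"
  let ?dZ = "\<lambda>\<tau>. vector_derivative Z (at \<tau> within {0..T})"
  \<comment> \<open>\<open>r\<close> is the form of the second block of \<open>Theta\<close>. It is
    constant along \<open>?\<xi>\<close>, so its primitive is \<open>\<tau> * r\<close>; the weight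
    \<theta> in \<open>\<phi>\<close> likewise comes from the first block.\<close>
  define r where "r = \<epsilon> * (norm v)\<^sup>2 + v \<bullet> (P i *v v) - v \<bullet> (P j *v v)"
  define \<phi> where "\<phi> \<tau> = ?\<xi> \<tau> \<bullet> (Z \<tau> *v ?\<xi> \<tau>)
    + \<theta> * ((E \<tau> *v v) \<bullet> (P i *v (E \<tau> *v v))) + \<tau> * r" for \<tau>
  define \<phi>' where "\<phi>' \<tau> = ?\<xi> \<tau> \<bullet> ((Theta A P \<epsilon> i j \<theta> + He (Z \<tau> ** ?D) + ?dZ \<tau>) *v ?\<xi> \<tau>)" for \<tau>
  have "(\<phi> has_vector_derivative \<phi>' \<tau>) (at \<tau> within {0..\<theta>})" if \<tau>: "\<tau> \<in> {0..\<theta>}" for \<tau>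
  proof -
    have "(Z has_vector_derivative ?dZ \<tau>) (at \<tau> within {0..T})"
      using Z(2) \<tau> \<open>\<theta> \<le> T\<close> by (auto simp: differentiable_on_def vector_derivative_works)
    then have dZ: "(Z has_vector_derivative ?dZ \<tau>) (at \<tau> within {0..\<theta>})"
      by (rule has_vector_derivative_within_subset) (use \<open>\<theta> \<le> T\<close> in auto)
    have dE: "((\<lambda>s. E s *v v) has_vector_derivative A i *v (E \<tau> *v v)) (at \<tau> within {0..\<theta>})"
      unfolding E_def by (rule mat_exp_flow_has_vector_derivative)
    \<comment> \<open>Only the first block moves with \<tau>; the initial and the final state are
      frozen, hence the two zero blocks of \<open>?D\<close>.\<close>
    then have d\<xi>: "(?\<xi> has_vector_derivative ?D *v ?\<xi> \<tau>) (at \<tau> within {0..\<theta>})"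
      using vjoin_has_vector_derivative[OF dE has_vector_derivative_const[of "vjoin v (E \<theta> *v v)"]]
      by simp
    have "sym_mat (Z \<tau>)"
      using Z(1) \<tau> \<open>\<theta> \<le> T\<close> by simp
    from has_vector_derivative_add[OF has_vector_derivative_add[OF
        quadratic_has_vector_derivative[where Z = Z, OF d\<xi> dZ this]
        has_vector_derivative_mult_right[OF quadratic_has_vector_derivative[OF dE
            has_vector_derivative_const P], where a = \<theta>]]
        has_vector_derivative_mult_left[OF has_vector_derivative_id, where a = r]]
    have "(\<phi> has_vector_derivative 2 * (?\<xi> \<tau> \<bullet> (Z \<tau> *v (?D *v ?\<xi> \<tau>))) + ?\<xi> \<tau> \<bullet> (?dZ \<tau> *v ?\<xi> \<tau>)
        + \<theta> * (2 * ((E \<tau> *v v) \<bullet> (P i *v (A i *v (E \<tau> *v v)))) + (E \<tau> *v v) \<bullet> (0 *v (E \<tau> *v v)))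
        + 1 * r) (at \<tau> within {0..\<theta>})"
      unfolding \<phi>_def .
    moreover have "?\<xi> \<tau> \<bullet> (He (Z \<tau> ** ?D) *v ?\<xi> \<tau>) = 2 * (?\<xi> \<tau> \<bullet> (Z \<tau> *v (?D *v ?\<xi> \<tau>)))"
      by (simp only: quadratic_He matrix_vector_mul_assoc)
    ultimately show ?thesis
      unfolding \<phi>'_def matrix_vector_mult_add_rdistrib inner_add_right quadratic_Theta
      by (simp add: r_def algebra_simps)
  qed
  moreover have "\<phi>' \<tau> \<le> 0" if "\<tau> \<in> {0..\<theta>}" for \<tau>
    using lmi[OF that] by (simp add: \<phi>'_def loewner_le_zero)
  ultimately have "\<phi> \<theta> \<le> \<phi> 0"
    using has_vector_derivative_nonpos_imp_le[of 0 \<theta> \<phi> \<phi>'] \<open>0 < \<theta>\<close> by simp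
  moreover have "?\<xi> \<theta> \<bullet> (Z \<theta> *v ?\<xi> \<theta>) = ?\<xi> 0 \<bullet> (Z 0 *v ?\<xi> 0)"
  proof -
    let ?w = "vjoin v (E \<theta> *v v)"
    have "?\<xi> \<theta> = W2 *v ?w" "?\<xi> 0 = W1 *v ?w"
      by (simp_all add: E_def)
    then show ?thesis
      using loop quadratic_congruence[of ?w W1 "Z 0"] quadratic_congruence[of ?w W2 "Z \<theta>"]
      by (simp only: right_minus_eq)
  qed
  \<comment> \<open>The right-hand side comes from \<open>E 0 = mat 1\<close>. After division by
    \<theta> it cancels against the \<open>P i\<close> term inside \<open>r\<close>, and
    \<open>P j\<close> remains.\<close>
  ultimately have "\<theta> * ((E \<theta> *v v) \<bullet> (P i *v (E \<theta> *v v)) + r) \<le> \<theta> * (v \<bullet> (P i *v v))"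
    by (simp add: \<phi>_def E_def algebra_simps)
  then show ?thesis
    using \<open>0 < \<theta>\<close> by (simp add: r_def)
qed


section \<open>From the dwell-time inequality to a looped functional\<close>

text \<open>Selectors of a, b and c. With them a form in (a, b, c) is assembled from matrix
  products, and its symmetry follows by \<open>sym_mat_intros\<close> without a look at block
  entries.\<close>

definition block1 :: "real^('n + 'n + 'n)^'n" where "block1 = (mat 1 \<^bold>| 0 \<^bold>| 0)"
definition block2 :: "real^('n + 'n + 'n)^'n" where "block2 = (0 \<^bold>| mat 1 \<^bold>| 0)"
definition block3 :: "real^('n + 'n + 'n)^'n" where "block3 = (0 \<^bold>| 0 \<^bold>| mat 1)"

lemma block_mult [simp]:
  "block1 *v vjoin a (vjoin b c) = a"
  "block2 *v vjoin a (vjoin b c) = b"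
  "block3 *v vjoin a (vjoin b c) = c"
  by (simp_all add: block1_def block2_def block3_def)

text \<open>
  Matrix of the quadratic form
  \<open>- \<theta> a\<^sup>T P a + \<theta> (G a - E b)\<^sup>T P (E b + c) - \<tau> b\<^sup>T (P - E\<^sup>T P E) b\<close>
  in \<open>(a, b, c)\<close>, where \<open>E = exp(A \<theta>)\<close> and \<open>G = exp(A (\<theta> - \<tau>))\<close>. Since \<open>G a\<close> is invariant when
  \<open>a\<close> moves along the flow, the middle term has zero derivative; it vanishes for \<open>\<tau> = 0, a = b\<close>,
  and at \<open>\<tau> = \<theta>, a = c\<close> it equals \<open>\<theta> (c\<^sup>T P c - b\<^sup>T E\<^sup>T P E b)\<close>, as needed to close the loop.
\<close>

definition loop_matrix ::
  "real^'n^'n \<Rightarrow> real^'n^'n \<Rightarrow> real \<Rightarrow> real \<Rightarrow> real^('n + 'n + 'n)^('n + 'n + 'n)" where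
  "loop_matrix A P \<theta> \<tau> =
    (let E = mat_exp (\<theta> *\<^sub>R A); G = mat_exp ((\<theta> - \<tau>) *\<^sub>R A) in
      (\<theta> / 2) *\<^sub>R He (transpose (G ** block1 - E ** block2) ** (P ** (E ** block2 + block3)))
      - \<theta> *\<^sub>R (transpose block1 ** P ** block1)
      - \<tau> *\<^sub>R (transpose block2 ** (P - transpose E ** P ** E) ** block2))"

definition loop_matrix_deriv ::
  "real^'n^'n \<Rightarrow> real^'n^'n \<Rightarrow> real \<Rightarrow> real \<Rightarrow> real^('n + 'n + 'n)^('n + 'n + 'n)" where
  "loop_matrix_deriv A P \<theta> \<tau> =
    (let E = mat_exp (\<theta> *\<^sub>R A); G = mat_exp ((\<theta> - \<tau>) *\<^sub>R A) in
      (\<theta> / 2) *\<^sub>R He (transpose (- (G ** A ** block1)) ** (P ** (E ** block2 + block3)))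
      - (transpose block2 ** (P - transpose E ** P ** E) ** block2))"

lemma He_has_vector_derivative:
  "(f has_vector_derivative f') F \<Longrightarrow> ((\<lambda>s. He (f s)) has_vector_derivative He f') F"
  unfolding He_def
  by (intro has_vector_derivative_add bounded_linear.has_vector_derivative[OF bounded_linear_transpose])

lemma loop_matrix_has_vector_derivative:
  "(loop_matrix A P \<theta> has_vector_derivative loop_matrix_deriv A P \<theta> \<tau>) (at \<tau> within S)"
proof -
  let ?E = "mat_exp (\<theta> *\<^sub>R A)"
  let ?M = "P ** (?E ** block2 + block3)" and ?R = "transpose block2 ** (P - transpose ?E ** P ** ?E) ** block2"
  note mult_left = bounded_linear.has_vector_derivative[OF bounded_bilinear.bounded_linear_left[OF
        bounded_bilinear_matrix_matrix_mult]]
  have "((\<lambda>s. mat_exp ((\<theta> - s) *\<^sub>R A) ** block1 - ?E ** block2) has_vector_derivative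
      - (mat_exp ((\<theta> - \<tau>) *\<^sub>R A) ** A) ** block1 - 0) (at \<tau> within S)"
    by (intro has_vector_derivative_diff has_vector_derivative_const
        mult_left[OF mat_exp_backward_has_vector_derivative])
  from has_vector_derivative_scaleR[OF DERIV_const
      He_has_vector_derivative[OF mult_left[OF bounded_linear.has_vector_derivative[OF
          bounded_linear_transpose this]]], of "\<theta> / 2" ?M]
  have 1: "((\<lambda>s. (\<theta> / 2) *\<^sub>R He (transpose (mat_exp ((\<theta> - s) *\<^sub>R A) ** block1 - ?E ** block2) ** ?M))
      has_vector_derivative
      (\<theta> / 2) *\<^sub>R He (transpose (- (mat_exp ((\<theta> - \<tau>) *\<^sub>R A) ** A ** block1)) ** ?M)) (at \<tau> within S)"
    by (simp add: bounded_bilinear.minus_left[OF bounded_bilinear_matrix_matrix_mult])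
  have 2: "((\<lambda>s. s *\<^sub>R ?R) has_vector_derivative ?R) (at \<tau> within S)"
    using has_vector_derivative_scaleR[OF DERIV_ident has_vector_derivative_const, of ?R \<tau> S] by simp
  from has_vector_derivative_diff[OF has_vector_derivative_diff[OF 1 has_vector_derivative_const] 2]
  show ?thesis
    by (simp add: loop_matrix_def[abs_def] loop_matrix_deriv_def Let_def)
qed

lemma sym_mat_loop_matrix: "sym_mat P \<Longrightarrow> sym_mat (loop_matrix A P \<theta> \<tau>)"
  unfolding loop_matrix_def Let_def by (intro sym_mat_intros)

lemma sym_mat_loop_matrix_deriv: "sym_mat P \<Longrightarrow> sym_mat (loop_matrix_deriv A P \<theta> \<tau>)"
  unfolding loop_matrix_deriv_def Let_def by (intro sym_mat_intros)

section \<open>Evaluation of the explicit functional\<close>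

lemma inner_He: "u \<bullet> (He X *v v) = u \<bullet> (X *v v) + (X *v u) \<bullet> v"
  by (simp only: He_def matrix_vector_mult_add_rdistrib inner_add_right inner_transpose)

lemma inner_transpose_mult: "u \<bullet> ((transpose X ** Y) *v v) = (X *v u) \<bullet> (Y *v v)"
  for X :: "real^'n^'m" and Y :: "real^'p^'m"
  by (simp only: matrix_vector_mul_assoc[symmetric] inner_transpose)

text \<open>Two different vectors are allowed because the \<open>He\<close> term of the matrix
  inequality pairs a vector with its image under \<open>diag3 (A i) 0 0\<close>.\<close>

lemma inner_loop_matrix:
  fixes A P :: "real^'n^'n" and \<theta> :: real
  assumes "sym_mat P"
  defines "E \<equiv> mat_exp (\<theta> *\<^sub>R A)" and "G \<equiv> \<lambda>\<tau>. mat_exp ((\<theta> - \<tau>) *\<^sub>R A)"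
  shows "vjoin a (vjoin b c) \<bullet> (loop_matrix A P \<theta> \<tau> *v vjoin a' (vjoin b' c')) =
    \<theta> / 2 * ((G \<tau> *v a - E *v b) \<bullet> (P *v (E *v b' + c'))
           + (G \<tau> *v a' - E *v b') \<bullet> (P *v (E *v b + c)))
    - \<theta> * (a \<bullet> (P *v a')) - \<tau> * (b \<bullet> (P *v b') - (E *v b) \<bullet> (P *v (E *v b')))"
  unfolding loop_matrix_def Let_def E_def G_def
  by (simp add: matrix_vector_mult_diff_rdistrib scaleR_matrix_vector_assoc[symmetric]
      inner_diff_right inner_He inner_transpose_mult matrix_mul_assoc[symmetric]
      matrix_vector_mul_assoc[symmetric] matrix_vector_mult_add_rdistrib
      inner_transpose inner_commute del: transpose_matrix_vector)

lemma quadratic_loop_matrix_deriv: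
  fixes A P :: "real^'n^'n" and \<theta> :: real
  defines "E \<equiv> mat_exp (\<theta> *\<^sub>R A)" and "G \<equiv> \<lambda>\<tau>. mat_exp ((\<theta> - \<tau>) *\<^sub>R A)"
  shows "vjoin a (vjoin b c) \<bullet> (loop_matrix_deriv A P \<theta> \<tau> *v vjoin a (vjoin b c)) =
    - \<theta> * ((G \<tau> *v (A *v a)) \<bullet> (P *v (E *v b + c))) - b \<bullet> (P *v b) + (E *v b) \<bullet> (P *v (E *v b))"
  unfolding loop_matrix_deriv_def Let_def E_def G_def
  by (simp add: matrix_vector_mult_diff_rdistrib scaleR_matrix_vector_assoc[symmetric]
      inner_diff_right quadratic_He inner_transpose_mult matrix_mul_assoc[symmetric]
      matrix_vector_mul_assoc[symmetric] matrix_vector_mult_add_rdistrib matrix_vector_uminus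
      inner_transpose inner_commute del: transpose_matrix_vector)

text \<open>Both congruences have the form \<open>- \<theta> * (b \<bullet> (P *v b))\<close>. At
  \<open>\<tau> = \<theta>\<close> this uses symmetry of \<open>P\<close>, by which the mixed terms
  of c - E b against c + E b cancel.\<close>

lemma loop_matrix_closes:
  assumes "sym_mat P"
  shows "transpose W2 ** loop_matrix A P \<theta> \<theta> ** W2 - transpose W1 ** loop_matrix A P \<theta> 0 ** W1 = 0"
proof (rule sym_mat_eq_0)
  show "sym_mat (transpose W2 ** loop_matrix A P \<theta> \<theta> ** W2 - transpose W1 ** loop_matrix A P \<theta> 0 ** W1)"
    by (intro sym_mat_intros sym_mat_loop_matrix assms)
  fix w :: "real^('a + 'a)"
  obtain b c where w: "w = vjoin b c"
    by (rule vjoin_exhaust)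
  show "w \<bullet> ((transpose W2 ** loop_matrix A P \<theta> \<theta> ** W2
      - transpose W1 ** loop_matrix A P \<theta> 0 ** W1) *v w) = 0"
    unfolding matrix_vector_mult_diff_rdistrib inner_diff_right quadratic_congruence w W1_mult W2_mult
      inner_loop_matrix[OF assms]
    using inner_sym_mat[OF assms, of "mat_exp (\<theta> *\<^sub>R A) *v b" c]
    by (simp add: matrix_vector_right_distrib inner_diff_left inner_add_right inner_commute algebra_simps)
qed

text \<open>Everything in a and c cancels. The first block of \<open>Theta\<close> is removed by the
  term - \<theta> a P a of the loop matrix, and the product of G A a with P (E b + c) occurs with
  opposite signs in the \<open>He\<close> term and in the derivative. What remains is
  \<open>dec\<close> at b, whatever \<tau> is.\<close>

lemma loop_matrix_inequality:
  fixes A P :: "nat \<Rightarrow> real^'n^'n"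
  assumes sym: "sym_mat (P i)" "sym_mat (P j)"
    and dec: "\<And>v. (mat_exp (\<theta> *\<^sub>R A i) *v v) \<bullet> (P i *v (mat_exp (\<theta> *\<^sub>R A i) *v v)) + \<epsilon> * (norm v)\<^sup>2
      \<le> v \<bullet> (P j *v v)"
  shows "Theta A P \<epsilon> i j \<theta> + He (loop_matrix (A i) (P i) \<theta> \<tau> ** diag3 (A i) 0 0)
    + loop_matrix_deriv (A i) (P i) \<theta> \<tau> \<preceq>\<^sub>L 0"
  unfolding loewner_le_zero
proof (intro conjI allI)
  show "sym_mat (Theta A P \<epsilon> i j \<theta> + He (loop_matrix (A i) (P i) \<theta> \<tau> ** diag3 (A i) 0 0)
    + loop_matrix_deriv (A i) (P i) \<theta> \<tau>)"
    by (intro sym_mat_intros sym_mat_Theta sym_mat_loop_matrix_deriv sym)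
  fix w :: "real^('n + 'n + 'n)"
  obtain a b c where w: "w = vjoin a (vjoin b c)"
    by (metis vjoin_exhaust)
  show "w \<bullet> ((Theta A P \<epsilon> i j \<theta> + He (loop_matrix (A i) (P i) \<theta> \<tau> ** diag3 (A i) 0 0)
    + loop_matrix_deriv (A i) (P i) \<theta> \<tau>) *v w) \<le> 0"
    unfolding w matrix_vector_mult_add_rdistrib inner_add_right quadratic_Theta quadratic_He
      matrix_vector_mul_assoc[symmetric] diag3_mult inner_loop_matrix[OF sym(1)]
      quadratic_loop_matrix_deriv
    using dec[of b] by (simp add: algebra_simps)
qed


section \<open>The equivalence\<close>

lemma loewner_less_iff_decrease:
  assumes "sym_mat P" "sym_mat Q"
  shows "mat_exp (\<theta> *\<^sub>R transpose A) ** P ** mat_exp (\<theta> *\<^sub>R A) - Q \<prec>\<^sub>L 0 \<longleftrightarrow>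
    (\<forall>v. v \<noteq> 0 \<longrightarrow>
      (mat_exp (\<theta> *\<^sub>R A) *v v) \<bullet> (P *v (mat_exp (\<theta> *\<^sub>R A) *v v)) < v \<bullet> (Q *v v))"
proof -
  let ?E = "mat_exp (\<theta> *\<^sub>R A)"
  have "mat_exp (\<theta> *\<^sub>R transpose A) = transpose ?E"
    by (simp add: transpose_mat_exp[symmetric] transpose_scalar)
  moreover have "sym_mat (transpose ?E ** P ** ?E - Q)"
    by (intro sym_mat_intros assms)
  ultimately show ?thesis
    by (simp add: loewner_less_zero matrix_vector_mult_diff_rdistrib inner_diff_right
        quadratic_congruence)
qed

text \<open>Compactness in \<theta> gives a margin for each pair of modes. Every smaller positive
  margin serves as well, so the finitely many pairs are combined as eventual statements at 0 from
  the right.\<close>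

lemma uniform_decrease:
  fixes A P :: "nat \<Rightarrow> real^'n^'n"
  assumes sym: "\<And>i. i \<in> {1..N} \<Longrightarrow> sym_mat (P i)"
    and less: "\<And>\<theta> i j. \<theta> \<in> {Tmin..Tmax} \<Longrightarrow> i \<in> {1..N} \<Longrightarrow> j \<in> {1..N} \<Longrightarrow> i \<noteq> j \<Longrightarrow>
      mat_exp (\<theta> *\<^sub>R transpose (A i)) ** P i ** mat_exp (\<theta> *\<^sub>R A i) - P j \<prec>\<^sub>L 0"
  obtains \<epsilon> where "\<epsilon> > 0"
    "\<And>\<theta> i j v. \<theta> \<in> {Tmin..Tmax} \<Longrightarrow> i \<in> {1..N} \<Longrightarrow> j \<in> {1..N} \<Longrightarrow> i \<noteq> j \<Longrightarrow>
      (mat_exp (\<theta> *\<^sub>R A i) *v v) \<bullet> (P i *v (mat_exp (\<theta> *\<^sub>R A i) *v v)) + \<epsilon> * (norm v)\<^sup>2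
        \<le> v \<bullet> (P j *v v)"
proof -
  define Q where "Q i j \<epsilon> \<longleftrightarrow> (\<forall>\<theta>\<in>{Tmin..Tmax}. \<forall>v.
      (mat_exp (\<theta> *\<^sub>R A i) *v v) \<bullet> (P i *v (mat_exp (\<theta> *\<^sub>R A i) *v v)) + \<epsilon> * (norm v)\<^sup>2
        \<le> v \<bullet> (P j *v v))" for i j \<epsilon>
  have ev: "\<forall>\<^sub>F \<epsilon> in at_right 0. i \<noteq> j \<longrightarrow> Q i j \<epsilon>" if ij: "i \<in> {1..N}" "j \<in> {1..N}" for i j
  proof (cases "i = j")
    case False
    define E where "E \<theta> = mat_exp (\<theta> *\<^sub>R A i)" for \<theta>
    have "continuous_on {Tmin..Tmax} E"
      unfolding E_def by (rule continuous_on_mat_exp)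
    then have cont: "continuous_on {Tmin..Tmax} (\<lambda>\<theta>. P j - transpose (E \<theta>) ** P i ** E \<theta>)"
      by (intro continuous_on_diff continuous_on_const
          bounded_bilinear.continuous_on[OF bounded_bilinear_matrix_matrix_mult]
          bounded_linear.continuous_on[OF bounded_linear_transpose])
    have "pos_def (P j - transpose (E \<theta>) ** P i ** E \<theta>)" if "\<theta> \<in> {Tmin..Tmax}" for \<theta>
      unfolding pos_def_def
    proof (intro conjI allI impI)
      show "sym_mat (P j - transpose (E \<theta>) ** P i ** E \<theta>)"
        by (intro sym_mat_intros sym ij)
      show "0 < v \<bullet> ((P j - transpose (E \<theta>) ** P i ** E \<theta>) *v v)" if "v \<noteq> 0" for v
        using less[OF \<open>\<theta> \<in> {Tmin..Tmax}\<close> ij False] that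
        unfolding loewner_less_iff_decrease[OF sym[OF ij(1)] sym[OF ij(2)]]
          matrix_vector_mult_diff_rdistrib inner_diff_right quadratic_congruence E_def by simp
    qed
    from quadratic_lower_bound[OF compact_Icc cont this] obtain m where "m > 0" and
      m: "\<And>\<theta> v. \<theta> \<in> {Tmin..Tmax} \<Longrightarrow>
        m * (norm v)\<^sup>2 \<le> v \<bullet> ((P j - transpose (E \<theta>) ** P i ** E \<theta>) *v v)"
      by blast
    have "Q i j \<epsilon>" if "\<epsilon> < m" for \<epsilon>
      unfolding Q_def
    proof (intro ballI allI)
      fix \<theta> v assume "\<theta> \<in> {Tmin..Tmax}"
      from m[OF this, of v] show "(mat_exp (\<theta> *\<^sub>R A i) *v v) \<bullet> (P i *v (mat_exp (\<theta> *\<^sub>R A i) *v v))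
          + \<epsilon> * (norm v)\<^sup>2 \<le> v \<bullet> (P j *v v)"
        using mult_right_mono[of \<epsilon> m "(norm v)\<^sup>2"] that
        unfolding matrix_vector_mult_diff_rdistrib inner_diff_right quadratic_congruence E_def by simp
    qed
    then show ?thesis
      using \<open>m > 0\<close> by (auto simp: eventually_at_right_field)
  qed simp
  have "\<forall>\<^sub>F \<epsilon> in at_right 0. \<forall>i\<in>{1..N}. \<forall>j\<in>{1..N}. i \<noteq> j \<longrightarrow> Q i j \<epsilon>"
    by (intro eventually_ball_finite finite_atLeastAtMost ballI ev)
  then obtain b where "b > 0" and b: "\<forall>\<epsilon>>0. \<epsilon> < b \<longrightarrow> (\<forall>i\<in>{1..N}. \<forall>j\<in>{1..N}. i \<noteq> j \<longrightarrow> Q i j \<epsilon>)"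
    unfolding eventually_at_right_field by auto
  \<comment> \<open>Validity is known only strictly below \<open>b\<close>, hence the half.\<close>
  from b[rule_format, of "b / 2"] \<open>b > 0\<close> show ?thesis
    by (intro that[of "b / 2"]) (simp_all add: Q_def)
qed

lemma dwell_imp_looped:
  fixes A :: "nat \<Rightarrow> real^'n^'n"
  assumes "0 < Tmin" "Tmin \<le> Tmax" "dwell_time_condition N A Tmin Tmax"
  shows "looped_functional_condition N A Tmin Tmax"
proof -
  obtain P :: "nat \<Rightarrow> real^'n^'n" where pd: "\<And>i. i \<in> {1..N} \<Longrightarrow> pos_def (P i)"
    and less: "\<And>\<theta> i j. \<theta> \<in> {Tmin..Tmax} \<Longrightarrow> i \<in> {1..N} \<Longrightarrow> j \<in> {1..N} \<Longrightarrow> i \<noteq> j \<Longrightarrow>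
      mat_exp (\<theta> *\<^sub>R transpose (A i)) ** P i ** mat_exp (\<theta> *\<^sub>R A i) - P j \<prec>\<^sub>L 0"
    using assms(3) unfolding dwell_time_condition_def by blast
  have sym: "sym_mat (P i)" if "i \<in> {1..N}" for i
    using pd[OF that] by (simp add: pos_def_def)
  obtain \<epsilon> where "\<epsilon> > 0" and dec:
    "\<And>\<theta> i j v. \<theta> \<in> {Tmin..Tmax} \<Longrightarrow> i \<in> {1..N} \<Longrightarrow> j \<in> {1..N} \<Longrightarrow> i \<noteq> j \<Longrightarrow>
      (mat_exp (\<theta> *\<^sub>R A i) *v v) \<bullet> (P i *v (mat_exp (\<theta> *\<^sub>R A i) *v v)) + \<epsilon> * (norm v)\<^sup>2
        \<le> v \<bullet> (P j *v v)"
    using uniform_decrease[of N P Tmin Tmax A, OF sym less] by blast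
  define Z where "Z i j \<tau> \<theta> = loop_matrix (A i) (P i) \<theta> \<tau>" for i j :: nat and \<tau> \<theta>
  show ?thesis
    unfolding looped_functional_condition_def
  proof (intro exI[of _ P] exI[of _ \<epsilon>] exI[of _ Z] conjI ballI impI)
    fix i j \<theta> assume ij: "i \<in> {1..N}" "j \<in> {1..N}" "i \<noteq> j" and \<theta>: "\<theta> \<in> {Tmin..Tmax}"
    have dZ: "((\<lambda>\<tau>. Z i j \<tau> \<theta>) has_vector_derivative loop_matrix_deriv (A i) (P i) \<theta> \<tau>)
        (at \<tau> within {0..Tmax})" for \<tau>
      unfolding Z_def by (rule loop_matrix_has_vector_derivative)
    show "sym_mat (Z i j \<tau> \<theta>)" for \<tau>
      unfolding Z_def by (intro sym_mat_loop_matrix sym ij)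
    show "(\<lambda>\<tau>. Z i j \<tau> \<theta>) differentiable_on {0..Tmax}"
      using dZ by (auto simp: differentiable_on_def intro: differentiableI_vector)
    show "transpose W2 ** Z i j \<theta> \<theta> ** W2 - transpose W1 ** Z i j 0 \<theta> ** W1 = 0"
      unfolding Z_def by (intro loop_matrix_closes sym ij)
    fix \<tau> assume "\<tau> \<in> {0..\<theta>}"
    \<comment> \<open>Since \<open>0 < Tmax\<close> the interval is nondegenerate, so derivatives
      within it are unique, also the one-sided ones at its end points.\<close>
    then have "vector_derivative (\<lambda>s. Z i j s \<theta>) (at \<tau> within {0..Tmax})
        = loop_matrix_deriv (A i) (P i) \<theta> \<tau>"
      using \<theta> assms by (intro vector_derivative_within_closed_interval dZ) auto
    then show "Theta A P \<epsilon> i j \<theta> + He (Z i j \<tau> \<theta> ** diag3 (A i) 0 0)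
        + vector_derivative (\<lambda>s. Z i j s \<theta>) (at \<tau> within {0..Tmax}) \<preceq>\<^sub>L 0"
      by (simp only: Z_def) (intro loop_matrix_inequality sym dec ij \<theta>)
  qed (use pd \<open>\<epsilon> > 0\<close> in auto)
qed

lemma looped_imp_dwell:
  fixes A :: "nat \<Rightarrow> real^'n^'n"
  assumes "0 < Tmin" "looped_functional_condition N A Tmin Tmax"
  shows "dwell_time_condition N A Tmin Tmax"
proof -
  obtain P :: "nat \<Rightarrow> real^'n^'n" and \<epsilon> Z where pd: "\<forall>i\<in>{1..N}. pos_def (P i)" and "\<epsilon> > 0"
    and Z: "\<forall>i\<in>{1..N}. \<forall>j\<in>{1..N}. i \<noteq> j \<longrightarrow> (\<forall>\<theta>\<in>{Tmin..Tmax}.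
      (\<forall>\<tau>\<in>{0..Tmax}. sym_mat (Z i j \<tau> \<theta>)) \<and>
      (\<lambda>\<tau>. Z i j \<tau> \<theta>) differentiable_on {0..Tmax} \<and>
      transpose W2 ** Z i j \<theta> \<theta> ** W2 - transpose W1 ** Z i j 0 \<theta> ** W1 = 0 \<and>
      (\<forall>\<tau>\<in>{0..\<theta>}. Theta A P \<epsilon> i j \<theta> + He (Z i j \<tau> \<theta> ** diag3 (A i) 0 0)
        + vector_derivative (\<lambda>s. Z i j s \<theta>) (at \<tau> within {0..Tmax}) \<preceq>\<^sub>L 0))"
    using assms(2) unfolding looped_functional_condition_def by (elim exE conjE) (rule that)
  have sym: "sym_mat (P i)" if "i \<in> {1..N}" for i
    using pd that by (simp add: pos_def_def)
  show ?thesis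
    unfolding dwell_time_condition_def
  proof (intro exI[of _ P] conjI ballI impI)
    fix i j \<theta> assume \<theta>: "\<theta> \<in> {Tmin..Tmax}" and ij: "i \<in> {1..N}" "j \<in> {1..N}" "i \<noteq> j"
    have "(mat_exp (\<theta> *\<^sub>R A i) *v v) \<bullet> (P i *v (mat_exp (\<theta> *\<^sub>R A i) *v v)) + \<epsilon> * (norm v)\<^sup>2
        \<le> v \<bullet> (P j *v v)" for v
      using Z[rule_format, OF ij \<theta>] \<theta> assms(1) sym[OF ij(1)]
      by (intro looped_functional_imp_decrease[of \<theta> Tmax P i "\<lambda>\<tau>. Z i j \<tau> \<theta>"]) simp_all
    \<comment> \<open>The positive \<epsilon> turns the semidefinite inequality into the strict
      one.\<close>
    moreover have "0 < \<epsilon> * (norm v)\<^sup>2" if "v \<noteq> 0" for v :: "real^'n"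
      using that \<open>\<epsilon> > 0\<close> by simp
    ultimately have "(mat_exp (\<theta> *\<^sub>R A i) *v v) \<bullet> (P i *v (mat_exp (\<theta> *\<^sub>R A i) *v v)) < v \<bullet> (P j *v v)"
      if "v \<noteq> 0" for v
      using that by (smt (verit))
    then show "mat_exp (\<theta> *\<^sub>R transpose (A i)) ** P i ** mat_exp (\<theta> *\<^sub>R A i) - P j \<prec>\<^sub>L 0"
      using loewner_less_iff_decrease[OF sym sym] ij by blast
  qed (use pd in auto)
qed


section \<open>Stability\<close>

lemma mat_exp_flow_bound:
  fixes A :: "real^'n^'n"
  shows "\<exists>C. \<forall>s\<in>{0..T}. \<forall>v. norm (mat_exp (s *\<^sub>R A) *v v) \<le> C * norm v"
proof -
  obtain K where "K > 0" and K: "\<And>(X::real^'n^'n) v. norm (X *v v) \<le> norm X * norm v * K"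
    using bounded_bilinear.pos_bounded[OF bounded_bilinear_matrix_vector_mult] by metis
  have "bounded ((\<lambda>s. mat_exp (s *\<^sub>R A)) ` {0..T})"
    by (intro compact_imp_bounded compact_continuous_image continuous_on_mat_exp compact_Icc)
  then obtain B where B: "\<And>s. s \<in> {0..T} \<Longrightarrow> norm (mat_exp (s *\<^sub>R A)) \<le> B"
    unfolding bounded_iff by blast
  have "norm (mat_exp (s *\<^sub>R A) *v v) \<le> (B * K) * norm v" if "s \<in> {0..T}" for s v
  proof -
    have "norm (mat_exp (s *\<^sub>R A)) * (norm v * K) \<le> B * (norm v * K)"
      using B[OF that] \<open>K > 0\<close> by (intro mult_right_mono) auto
    then show ?thesis
      using K[of "mat_exp (s *\<^sub>R A)" v] by (simp add: algebra_simps)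
  qed
  then show ?thesis
    by blast
qed

lemma uniform_flow_bound:
  fixes A :: "nat \<Rightarrow> real^'n^'n"
  obtains C where "C > 0"
    "\<And>i s v. i \<in> {1..N} \<Longrightarrow> s \<in> {0..T} \<Longrightarrow> norm (mat_exp (s *\<^sub>R A i) *v v) \<le> C * norm v"
proof -
  have ev: "\<forall>\<^sub>F C in at_top. \<forall>s\<in>{0..T}. \<forall>v. norm (mat_exp (s *\<^sub>R A i) *v v) \<le> C * norm v" for i
  proof -
    obtain C0 where C0: "\<forall>s\<in>{0..T}. \<forall>v. norm (mat_exp (s *\<^sub>R A i) *v v) \<le> C0 * norm v"
      using mat_exp_flow_bound by blast
    have "\<forall>s\<in>{0..T}. \<forall>v. norm (mat_exp (s *\<^sub>R A i) *v v) \<le> C * norm v" if "C0 \<le> C" for C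
      using C0 mult_right_mono[OF that norm_ge_zero] order_trans by blast
    then show ?thesis
      unfolding eventually_at_top_linorder by blast
  qed
  have "\<forall>\<^sub>F C in at_top. C > 0 \<and> (\<forall>i\<in>{1..N}. \<forall>s\<in>{0..T}. \<forall>v.
      norm (mat_exp (s *\<^sub>R A i) *v v) \<le> C * norm v)"
    by (intro eventually_conj eventually_gt_at_top ballI ev
        eventually_ball_finite[OF finite_atLeastAtMost[of "1 :: nat" N]])
  then show ?thesis
    using that eventually_happens' trivial_limit_at_top_linorder by (metis (no_types, lifting))
qed

text \<open>Bounds persist for smaller \<open>m\<close> and larger \<open>c\<close>, so the modes
  are combined by eventual statements at 0 and at infinity. The prescribed \<open>b\<close> will be
  the margin \<epsilon>, which makes the contraction factor \<open>1 - \<epsilon> / c\<close>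
  positive.\<close>

lemma uniform_quadratic_bounds:
  fixes P :: "nat \<Rightarrow> real^'n^'n"
  assumes pd: "\<And>i. i \<in> {1..N} \<Longrightarrow> pos_def (P i)"
  obtains m c where "m > 0" "c > b"
    "\<And>i v. i \<in> {1..N} \<Longrightarrow> m * (norm v)\<^sup>2 \<le> v \<bullet> (P i *v v)"
    "\<And>i v. i \<in> {1..N} \<Longrightarrow> v \<bullet> (P i *v v) \<le> c * (norm v)\<^sup>2"
proof -
  have ev: "\<forall>\<^sub>F m in at_right 0. \<forall>v. m * (norm v)\<^sup>2 \<le> v \<bullet> (P i *v v)" if i: "i \<in> {1..N}" for i
  proof -
    obtain m0 where "m0 > 0" and m0: "\<And>v. m0 * (norm v)\<^sup>2 \<le> v \<bullet> (P i *v v)"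
      using pos_def_lower_bound[OF pd[OF i]] by metis
    have "\<forall>v. m * (norm v)\<^sup>2 \<le> v \<bullet> (P i *v v)" if "m < m0" for m
      using m0 mult_right_mono[of m m0] that by (meson less_imp_le order_trans zero_le_power2)
    then show ?thesis
      using \<open>m0 > 0\<close> by (auto simp: eventually_at_right_field)
  qed
  have "\<forall>\<^sub>F m in at_right 0. \<forall>i\<in>{1..N}. \<forall>v. m * (norm v)\<^sup>2 \<le> v \<bullet> (P i *v v)"
    by (intro eventually_ball_finite finite_atLeastAtMost ballI ev)
  then obtain m0 where m0: "m0 > 0"
    "\<forall>m>0. m < m0 \<longrightarrow> (\<forall>i\<in>{1..N}. \<forall>v. m * (norm v)\<^sup>2 \<le> v \<bullet> (P i *v v))"
    unfolding eventually_at_right_field by auto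
  define m where "m = m0 / 2"
  have m: "m > 0" "\<forall>i\<in>{1..N}. \<forall>v. m * (norm v)\<^sup>2 \<le> v \<bullet> (P i *v v)"
    using m0(1) m0(2)[rule_format, of m] by (simp_all add: m_def)
  have ev2: "\<forall>\<^sub>F c in at_top. \<forall>v. v \<bullet> (P i *v v) \<le> c * (norm v)\<^sup>2" for i
  proof -
    obtain c0 where c0: "\<And>v. v \<bullet> (P i *v v) \<le> c0 * (norm v)\<^sup>2"
      using quadratic_upper_bound by metis
    have "\<forall>v. v \<bullet> (P i *v v) \<le> c * (norm v)\<^sup>2" if "c0 \<le> c" for c
      using c0 mult_right_mono[OF that] by (meson order_trans zero_le_power2)
    then show ?thesis
      unfolding eventually_at_top_linorder by blast
  qed
  have "\<forall>\<^sub>F c in at_top. c > b \<and> (\<forall>i\<in>{1..N}. \<forall>v. v \<bullet> (P i *v v) \<le> c * (norm v)\<^sup>2)"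
    by (intro eventually_conj eventually_gt_at_top ballI ev2
        eventually_ball_finite[OF finite_atLeastAtMost[of "1 :: nat" N]])
  then obtain c where "c > b" "\<forall>i\<in>{1..N}. \<forall>v. v \<bullet> (P i *v v) \<le> c * (norm v)\<^sup>2"
    using eventually_happens' trivial_limit_at_top_linorder by (metis (no_types, lifting))
  with m show ?thesis
    using that by blast
qed

section \<open>Solutions along a switching signal\<close>

lemma switching_times_nonneg: "switching_signal N \<sigma> t \<Longrightarrow> 0 \<le> t k"
  unfolding switching_signal_def by (metis strict_mono_less_eq zero_le)

text \<open>Dwell times of at least \<open>Tmin\<close> keep the switching times from accumulating.
  The growth bound is shifted by one index because the initial interval has no lower bound on its
  length. Having \<open>n \<le> k\<close> makes the decay reached at index \<open>n\<close>
  available from time \<open>t n\<close> on.\<close>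

lemma dwell_interval_exists:
  assumes sw: "switching_signal N \<sigma> t" and dw: "dwell_times_in Tmin Tmax t" and "0 < Tmin"
    and s: "t n \<le> s"
  obtains k where "n \<le> k" "s \<in> {t k..t (Suc k)}"
proof -
  have mono: "strict_mono t"
    using sw by (simp add: switching_signal_def)
  have growth: "real k * Tmin \<le> t (Suc k)" for k
  proof (induction k)
    case 0
    show ?case using switching_times_nonneg[OF sw] by simp
  next
    case (Suc k)
    have "t (Suc k) + Tmin \<le> t (Suc (Suc k))"
      using dw by (auto simp: dwell_times_in_def dest: spec[of _ "Suc k"])
    with Suc show ?case by (simp add: algebra_simps)
  qed
  obtain k0 where "s < real k0 * Tmin"
    using reals_Archimedean3[OF \<open>0 < Tmin\<close>] by blast
  then have ex: "s < t (Suc k0)"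
    using growth[of k0] by simp
  define k where "k = (LEAST k. s < t (Suc k))"
  have k: "s < t (Suc k)"
    unfolding k_def by (rule LeastI[of _ k0]) (rule ex)
  have "n \<le> k"
  proof (rule ccontr)
    assume "\<not> n \<le> k"
    then have "t (Suc k) \<le> t n"
      using mono by (simp add: strict_mono_less_eq)
    with k s show False by simp
  qed
  moreover have "t k \<le> s"
  proof (cases "k = n")
    case False
    with \<open>n \<le> k\<close> obtain j where j: "k = Suc j"
      by (cases k) auto
    have "\<not> s < t (Suc j)"
      using not_less_Least[of j "\<lambda>k. s < t (Suc k)"] j unfolding k_def[symmetric] by simp
    then show ?thesis
      by (simp add: j)
  qed (use s in simp)
  ultimately show ?thesis
    using that k by simp
qed

text \<open>The right end point is included thanks to continuity of \<open>x\<close>, although the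
  equation may fail there; this is what chains consecutive intervals.\<close>

lemma switched_solution_flow:
  fixes A :: "nat \<Rightarrow> real^'n^'n"
  assumes sw: "switching_signal N \<sigma> t" and x: "switched_solution A \<sigma> t x0 x"
    and s: "s \<in> {t k..t (Suc k)}"
  shows "x s = mat_exp ((s - t k) *\<^sub>R A (\<sigma> (t k))) *v x (t k)"
proof (rule linear_ode_solution)
  show "t k \<le> s"
    using s by simp
  show "continuous_on {t k..s} x"
    using x switching_times_nonneg[OF sw, of k]
    unfolding switched_solution_def by (auto intro: continuous_on_subset)
  fix r assume r: "r \<in> {t k<..<s}"
  have "\<forall>k. \<forall>s\<in>{t k..<t (Suc k)}. \<sigma> s = \<sigma> (t k)"
    using sw unfolding switching_signal_def by blast
  then have "\<sigma> r = \<sigma> (t k)"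
    using r s by simp
  moreover have "(x has_vector_derivative A (\<sigma> r) *v x r) (at r)"
    using x r s unfolding switched_solution_def by (auto dest!: spec[of _ k])
  ultimately show "(x has_vector_derivative A (\<sigma> (t k)) *v x r) (at r)"
    by simp
qed

text \<open>
  At the switching time \<open>t (Suc k)\<close> the state is measured with the matrix \<open>P\<close> of the mode that has
  just been left, so that the inequality for the pair of consecutive modes applies.
\<close>

lemma switched_solution_decay:
  fixes A :: "nat \<Rightarrow> real^'n^'n"
  assumes "0 < Tmin" and sw: "switching_signal N \<sigma> t" and dw: "dwell_times_in Tmin Tmax t"
    and "dwell_time_condition N A Tmin Tmax"
  obtains K \<rho> where "K > 0" "0 < \<rho>" "\<rho> < 1"
    "\<And>x0 x k s. switched_solution A \<sigma> t x0 x \<Longrightarrow> s \<in> {t k..t (Suc k)} \<Longrightarrow>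
      (norm (x s))\<^sup>2 \<le> K * \<rho> ^ k * (norm x0)\<^sup>2"
proof -
  obtain P :: "nat \<Rightarrow> real^'n^'n" where pd: "\<And>i. i \<in> {1..N} \<Longrightarrow> pos_def (P i)"
    and less: "\<And>\<theta> i j. \<theta> \<in> {Tmin..Tmax} \<Longrightarrow> i \<in> {1..N} \<Longrightarrow> j \<in> {1..N} \<Longrightarrow> i \<noteq> j \<Longrightarrow>
      mat_exp (\<theta> *\<^sub>R transpose (A i)) ** P i ** mat_exp (\<theta> *\<^sub>R A i) - P j \<prec>\<^sub>L 0"
    using assms(4) unfolding dwell_time_condition_def by blast
  have sym: "sym_mat (P i)" if "i \<in> {1..N}" for i
    using pd[OF that] by (simp add: pos_def_def)
  obtain \<epsilon> where "\<epsilon> > 0" and dec: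
    "\<And>\<theta> i j v. \<theta> \<in> {Tmin..Tmax} \<Longrightarrow> i \<in> {1..N} \<Longrightarrow> j \<in> {1..N} \<Longrightarrow> i \<noteq> j \<Longrightarrow>
      (mat_exp (\<theta> *\<^sub>R A i) *v v) \<bullet> (P i *v (mat_exp (\<theta> *\<^sub>R A i) *v v)) + \<epsilon> * (norm v)\<^sup>2
        \<le> v \<bullet> (P j *v v)"
    using uniform_decrease[of N P Tmin Tmax A, OF sym less] by blast
  obtain m c where "m > 0" "c > \<epsilon>"
    and m: "\<And>i v. i \<in> {1..N} \<Longrightarrow> m * (norm v)\<^sup>2 \<le> v \<bullet> (P i *v v)"
    and c: "\<And>i v. i \<in> {1..N} \<Longrightarrow> v \<bullet> (P i *v v) \<le> c * (norm v)\<^sup>2"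
    using uniform_quadratic_bounds[of N P \<epsilon>, OF pd] by blast
  \<comment> \<open>The initial interval may be longer than \<open>Tmax\<close>, so the flow bound
    has to cover \<open>t 1\<close> as well. \<open>C\<close> depends on the signal but not on the
    solution.\<close>
  obtain C where "C > 0" and C: "\<And>i s v. i \<in> {1..N} \<Longrightarrow> s \<in> {0..max Tmax (t 1)} \<Longrightarrow>
      norm (mat_exp (s *\<^sub>R A i) *v v) \<le> C * norm v"
    using uniform_flow_bound[of N "max Tmax (t 1)" A] by blast
  \<comment> \<open>The decrease by \<epsilon> times the squared norm is at least the fraction
    \<open>\<epsilon> / c\<close> of the current form.\<close>
  define \<rho> where "\<rho> = 1 - \<epsilon> / c"
  have \<rho>: "0 < \<rho>" "\<rho> < 1"
    using \<open>\<epsilon> > 0\<close> \<open>c > \<epsilon>\<close> by (simp_all add: \<rho>_def)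
  define i where "i k = \<sigma> (t k)" for k
  have i: "i k \<in> {1..N}" for k
    using sw switching_times_nonneg[OF sw] unfolding switching_signal_def i_def by blast
  have t0: "t 0 = 0"
    using sw by (simp add: switching_signal_def)
  have dwell: "t (Suc (Suc k)) - t (Suc k) \<in> {Tmin..Tmax}" for k
    using dw unfolding dwell_times_in_def by simp
  have len: "t (Suc k) - t k \<le> max Tmax (t 1)" for k
    using dwell t0 by (cases k) (auto simp: le_max_iff_disj)
  \<comment> \<open>The first summand serves \<open>k = 0\<close>. In the second, one factor
    \<open>C\<^sup>2\<close> leads from time 0 to \<open>t 1\<close> and one from \<open>t k\<close>
    to \<open>s\<close>, \<open>c / m\<close> compares form and norm, and the division by \<rho>
    accounts for the \<open>k - 1\<close> contractions available at \<open>t k\<close>.\<close>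
  define K where "K = C\<^sup>2 + C ^ 4 * c / (m * \<rho>)"
  have decay: "(norm (x s))\<^sup>2 \<le> K * \<rho> ^ k * (norm x0)\<^sup>2"
    if x: "switched_solution A \<sigma> t x0 x" and s: "s \<in> {t k..t (Suc k)}" for x0 x k s
  proof -
    have flow: "(norm (x s))\<^sup>2 \<le> C\<^sup>2 * (norm (x (t k)))\<^sup>2" if "s \<in> {t k..t (Suc k)}" for k s
    proof -
      have "norm (x s) \<le> C * norm (x (t k))"
        unfolding switched_solution_flow[OF sw x that]
        using C[OF i[of k], of "s - t k" "x (t k)"] that len[of k] by (simp add: i_def)
      then show ?thesis
        using power_mono[of "norm (x s)" "C * norm (x (t k))" 2] by (simp add: power_mult_distrib)
    qed
    have start: "x (t 0) = x0"
      using x t0 by (simp add: switched_solution_def)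
    show ?thesis
    proof (cases k)
      case 0
      have "C\<^sup>2 \<le> K"
        using \<open>C > 0\<close> \<open>c > \<epsilon>\<close> \<open>\<epsilon> > 0\<close> \<open>m > 0\<close> \<rho> by (simp add: K_def)
      then have "C\<^sup>2 * (norm x0)\<^sup>2 \<le> K * (norm x0)\<^sup>2"
        by (rule mult_right_mono) simp
      with flow[of s 0] s start show ?thesis
        by (simp add: 0)
    next
      case (Suc n)
      \<comment> \<open>The sequence starts at \<open>t 1\<close>: at time 0 no mode has been left
        yet.\<close>
      define V where "V k = x (t (Suc k)) \<bullet> (P (i k) *v x (t (Suc k)))" for k
      have step: "V (Suc k) \<le> \<rho> * V k" for k
      proof -
        have "i (Suc k) \<noteq> i k"
          using sw by (simp add: switching_signal_def i_def)
        moreover have "x (t (Suc (Suc k))) =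
            mat_exp ((t (Suc (Suc k)) - t (Suc k)) *\<^sub>R A (i (Suc k))) *v x (t (Suc k))"
          using switched_solution_flow[OF sw x, of "t (Suc (Suc k))" "Suc k"] dwell[of k] \<open>0 < Tmin\<close>
          by (simp add: i_def)
        ultimately have "V (Suc k) + \<epsilon> * (norm (x (t (Suc k))))\<^sup>2 \<le> V k"
          unfolding V_def using dec[OF dwell i i] by metis
        moreover have "\<epsilon> / c * V k \<le> \<epsilon> * (norm (x (t (Suc k))))\<^sup>2"
          using mult_left_mono[OF c[OF i[of k], of "x (t (Suc k))"], of "\<epsilon> / c"] \<open>c > \<epsilon>\<close> \<open>\<epsilon> > 0\<close>
          by (simp add: V_def)
        ultimately show ?thesis
          by (simp add: \<rho>_def algebra_simps)
      qed
      have "V n \<le> \<rho> ^ n * V 0"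
      proof (induction n)
        case (Suc n)
        show ?case
          using order.trans[OF step[of n] mult_left_mono[OF Suc, of \<rho>]] \<rho> by (simp add: mult.assoc)
      qed simp
      moreover have "V 0 \<le> c * (norm (x (t 1)))\<^sup>2"
        using c[OF i] by (simp add: V_def)
      then have "V 0 \<le> c * (C\<^sup>2 * (norm x0)\<^sup>2)"
        using order.trans[OF _ mult_left_mono[OF flow[of "t 1" 0], of c]] start \<open>c > \<epsilon>\<close> \<open>\<epsilon> > 0\<close>
          switching_times_nonneg[OF sw, of 1] t0 by simp
      then have "\<rho> ^ n * V 0 \<le> \<rho> ^ n * (c * (C\<^sup>2 * (norm x0)\<^sup>2))"
        using \<rho> by (intro mult_left_mono) auto
      moreover have "m * (norm (x (t k)))\<^sup>2 \<le> V n"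
        using m[OF i] by (simp add: V_def Suc)
      ultimately have "m * (norm (x (t k)))\<^sup>2 \<le> \<rho> ^ n * (c * (C\<^sup>2 * (norm x0)\<^sup>2))"
        by linarith
      then have "(norm (x (t k)))\<^sup>2 \<le> \<rho> ^ n * (c * (C\<^sup>2 * (norm x0)\<^sup>2)) / m"
        using \<open>m > 0\<close> by (simp add: field_simps)
      then have "C\<^sup>2 * (norm (x (t k)))\<^sup>2 \<le> C\<^sup>2 * (\<rho> ^ n * (c * (C\<^sup>2 * (norm x0)\<^sup>2)) / m)"
        by (rule mult_left_mono) simp
      also have "\<dots> = (C ^ 4 * c / (m * \<rho>)) * (\<rho> ^ k * (norm x0)\<^sup>2)"
        using \<rho> \<open>m > 0\<close> by (simp add: Suc field_simps power4_eq_xxxx power2_eq_square)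
      also have "\<dots> \<le> K * (\<rho> ^ k * (norm x0)\<^sup>2)"
        using \<rho> by (intro mult_right_mono) (auto simp: K_def)
      finally show ?thesis
        using flow[OF s] by (simp add: mult.assoc)
    qed
  qed
  have "K > 0"
    using \<open>C > 0\<close> \<open>c > \<epsilon>\<close> \<open>\<epsilon> > 0\<close> \<open>m > 0\<close> \<rho> by (simp add: K_def add_pos_pos)
  with \<rho> decay show ?thesis
    using that by blast
qed

lemma dwell_imp_stable:
  fixes A :: "nat \<Rightarrow> real^'n^'n"
  assumes "0 < Tmin" and cond: "dwell_time_condition N A Tmin Tmax"
  shows "asymptotically_stable_dwell N A Tmin Tmax"
  unfolding asymptotically_stable_dwell_def
proof (intro allI impI, elim conjE)
  fix \<sigma> t
  assume sw: "switching_signal N \<sigma> t" and dw: "dwell_times_in Tmin Tmax t"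
  note interval = dwell_interval_exists[OF sw dw \<open>0 < Tmin\<close>]
  have t0: "t 0 = 0"
    using sw by (simp add: switching_signal_def)
  obtain K \<rho> where "K > 0" and \<rho>: "0 < \<rho>" "\<rho> < 1"
    and decay: "\<And>x0 x k s. switched_solution A \<sigma> t x0 x \<Longrightarrow> s \<in> {t k..t (Suc k)} \<Longrightarrow>
      (norm (x s))\<^sup>2 \<le> K * \<rho> ^ k * (norm x0)\<^sup>2"
    using switched_solution_decay[OF \<open>0 < Tmin\<close> sw dw cond] by blast
  \<comment> \<open>One estimate serves both claims: \<open>n = 0\<close> gives Lyapunov stability
    with radius \<open>e / sqrt K\<close>, and a large \<open>n\<close> gives convergence.\<close>
  have bound: "(norm (x s))\<^sup>2 \<le> K * \<rho> ^ n * (norm x0)\<^sup>2"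
    if x: "switched_solution A \<sigma> t x0 x" and s: "t n \<le> s" for x0 x s n
  proof -
    obtain k where "n \<le> k" and k: "s \<in> {t k..t (Suc k)}"
      using interval[OF s] by blast
    have "K * \<rho> ^ k * (norm x0)\<^sup>2 \<le> K * \<rho> ^ n * (norm x0)\<^sup>2"
      using \<open>n \<le> k\<close> \<rho> \<open>K > 0\<close> by (intro mult_right_mono mult_left_mono power_decreasing) auto
    with decay[OF x k] show ?thesis
      by simp
  qed
  show "asymptotically_stable_signal A \<sigma> t"
    unfolding asymptotically_stable_signal_def
  proof (intro conjI allI impI)
    fix e :: real assume "e > 0"
    show "\<exists>d>0. \<forall>x0 x. switched_solution A \<sigma> t x0 x \<and> norm x0 < d \<longrightarrow> (\<forall>s\<ge>0. norm (x s) < e)"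
    proof (intro exI[of _ "e / sqrt K"] conjI allI impI)
      show "0 < e / sqrt K"
        using \<open>e > 0\<close> \<open>K > 0\<close> by simp
      fix x0 x s
      assume *: "switched_solution A \<sigma> t x0 x \<and> norm x0 < e / sqrt K" and "0 \<le> (s::real)"
      have "(norm x0)\<^sup>2 < (e / sqrt K)\<^sup>2"
        using * by (intro power_strict_mono) auto
      then have "K * (norm x0)\<^sup>2 < e\<^sup>2"
        using \<open>K > 0\<close> by (simp add: power_divide field_simps)
      moreover have "(norm (x s))\<^sup>2 \<le> K * (norm x0)\<^sup>2"
        using bound[of x0 x 0 s] * \<open>0 \<le> s\<close> t0 by simp
      ultimately show "norm (x s) < e"
        using \<open>e > 0\<close> by (intro power_less_imp_less_base[of _ 2 e]) auto
    qed
  next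
    fix x0 x assume x: "switched_solution A \<sigma> t x0 x"
    show "(x \<longlongrightarrow> 0) at_top"
    proof (rule tendstoI)
      fix e :: real assume "e > 0"
      have "(\<lambda>n. K * \<rho> ^ n * (norm x0)\<^sup>2) \<longlonglongrightarrow> K * 0 * (norm x0)\<^sup>2"
        using \<rho> by (intro tendsto_intros LIMSEQ_power_zero) auto
      then have "\<forall>\<^sub>F n in sequentially. K * \<rho> ^ n * (norm x0)\<^sup>2 < e\<^sup>2"
        using \<open>e > 0\<close> by (intro order_tendstoD(2)) auto
      then obtain n where n: "K * \<rho> ^ n * (norm x0)\<^sup>2 < e\<^sup>2"
        by (auto simp: eventually_sequentially)
      have "norm (x s) < e" if "t n \<le> s" for s
        using bound[OF x that] n \<open>e > 0\<close> by (intro power_less_imp_less_base[of _ 2 e]) auto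
      then show "\<forall>\<^sub>F s in at_top. dist (x s) 0 < e"
        unfolding eventually_at_top_linorder by auto
    qed
  qed
qed

theorem corollary4p4:
  fixes N :: nat and A :: "nat \<Rightarrow> real^'n^'n" and \<delta> Tmin Tmax :: real
  assumes "N \<ge> 1" and "0 < \<delta>" and "\<delta> \<le> Tmin" and "Tmin \<le> Tmax"
  shows "(dwell_time_condition N A Tmin Tmax \<longleftrightarrow> looped_functional_condition N A Tmin Tmax) \<and>
         (dwell_time_condition N A Tmin Tmax \<and> looped_functional_condition N A Tmin Tmax
            \<longrightarrow> asymptotically_stable_dwell N A Tmin Tmax)"
  using dwell_imp_looped[of Tmin Tmax N A] looped_imp_dwell[of Tmin N A Tmax]
    dwell_imp_stable[of Tmin N A Tmax] assms by auto

end
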